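(* Let $T_1$ be the tanglegram of size $4$ whose left tree is the caterpillar $(((a,b),c),d)$ and whose right tree is the caterpillar $(((a,d),c),b)$, and let $T_2$ be the tanglegram of size $4$ whose left tree is $((a,b),(c,d))$ and whose right tree is $((a,c),(b,d))$, where in both cases the leaf of the left tree labelled $x$ is matched to the leaf of the right tree labelled $x$. Then the crossing-critical tanglegrams are exactly $T_1$ and $T_2$, i.e., a tanglegram is crossing-critical if and only if it equals $T_1$ or $T_2$. Consequently, every non-planar tanglegram contains $T_1$ or $T_2$ as an induced subtanglegram.
   Context: A plane binary tree is a rooted tree in which every vertex has either two ordered children (up and down) or none (a leaf); a single vertex is allowed. A tanglegram layout $(L,R,\sigma)$ consists of a plane binary tree $L$ with root $r$ drawn in the half-plane $x\le 0$ with its leaves on the line $x=0$, a plane binary tree $R$ with root $\rho$ drawn in $x\ge 1$ with its leaves on the line $x=1$, both with $n$ leaves, and a perfect matching $\sigma$ between the two leaf sets drawn as straight segments (the matching edges). A switch at an internal vertex $v$ of $L$ or $R$ interchanges the up- and down-subtrees of $v$ (matching edges move with their leaves). A tanglegram is an equivalence class of layouts under sequences of switches; equivalently, a pair of rooted (unordered) binary trees with a bijection between their leaf sets, up to isomorphism; interchanging $L$ and $R$ is not allowed. The size is $n$. Notation such as $(((a,b),c),d)$ denotes the rooted binary tree whose root has children leaf $d$ and a vertex whose children are leaf $c$ and a vertex with children leaves $a,b$. A tanglegram is planar if it has a layout in which no two matching edges cross, non-planar otherwise. For a set $E$ of matching edges, the subtanglegram induced by $E$ is obtained by taking in each tree the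 smallest subtree containing the leaves incident to $E$, rooting it at its vertex closest to the original root, suppressing all degree-2 non-root vertices, and keeping the matching edges of $E$. A tanglegram is crossing-critical if it is non-planar but every proper induced subtanglegram of it is planar. *)

theory Defs
  imports Main
begin

section \<open>Plane binary trees\<close>

text \<open>The leaves carry names, by which matching edges refer to them; in \<open>Node u d\<close> the tree
  \<open>u\<close> is the up-subtree and \<open>d\<close> the down-subtree.\<close>

datatype (leaf_set: 'a) ptree = Leaf 'a | Node "'a ptree" "'a ptree"

text \<open>The leaves in the order, from top to bottom, in which a plane drawing puts them on
  the vertical line.\<close>

fun leaves :: "'a ptree \<Rightarrow> 'a list" where
  "leaves (Leaf x) = [x]"
| "leaves (Node u d) = leaves u @ leaves d"

definition above :: "'a ptree \<Rightarrow> 'a \<Rightarrow> 'a \<Rightarrow> bool" where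
  "above t x y \<longleftrightarrow> (\<exists>i j. i < j \<and> j < length (leaves t) \<and> leaves t ! i = x \<and> leaves t ! j = y)"

inductive switch_tree :: "'a ptree \<Rightarrow> 'a ptree \<Rightarrow> bool" where
  here: "switch_tree (Node u d) (Node d u)"
| up: "switch_tree u u' \<Longrightarrow> switch_tree (Node u d) (Node u' d)"
| down: "switch_tree d d' \<Longrightarrow> switch_tree (Node u d) (Node u d')"

text \<open>For a set \<open>A\<close> containing at least one leaf of the tree, \<open>restrict_tree A\<close> yields the
  smallest subtree containing the leaves in \<open>A\<close>, rooted at its vertex closest to the root,
  with the non-root vertices of degree 2 suppressed: a vertex with both subtrees meeting \<open>A\<close>
  survives; a vertex with only one subtree meeting \<open>A\<close> either lies above the new root or has
  degree 2 in the smallest subtree.  If no leaf lies in \<open>A\<close> the value is irrelevant.\<close>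

fun restrict_tree :: "'a set \<Rightarrow> 'a ptree \<Rightarrow> 'a ptree" where
  "restrict_tree A (Leaf x) = Leaf x"
| "restrict_tree A (Node u d) =
    (if leaf_set u \<inter> A = {} then restrict_tree A d
     else if leaf_set d \<inter> A = {} then restrict_tree A u
     else Node (restrict_tree A u) (restrict_tree A d))"

lemma set_leaves: "set (leaves t) = leaf_set t"
  by (induction t) auto

lemma leaves_map: "leaves (map_ptree f t) = map f (leaves t)"
  by (induction t) auto

lemma switch_tree_sym: "switch_tree s t \<Longrightarrow> switch_tree t s"
  by (induction rule: switch_tree.induct) (auto intro: switch_tree.intros)

lemma switch_tree_map: "switch_tree s t \<Longrightarrow> switch_tree (map_ptree f s) (map_ptree f t)"
  by (induction rule: switch_tree.induct) (auto intro: switch_tree.intros)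

lemma switch_tree_leaf_set: "switch_tree s t \<Longrightarrow> leaf_set t = leaf_set s"
  by (induction rule: switch_tree.induct) auto

lemma switch_tree_distinct: "switch_tree s t \<Longrightarrow> distinct (leaves t) = distinct (leaves s)"
proof (induction rule: switch_tree.induct)
  case (here u d)
  then show ?case by auto
next
  case (up u u' d)
  then show ?case using switch_tree_leaf_set[of u u'] by (auto simp: set_leaves)
next
  case (down d d' u)
  then show ?case using switch_tree_leaf_set[of d d'] by (auto simp: set_leaves)
qed

lemma restrict_tree_leaf_set:
  "leaf_set t \<inter> A \<noteq> {} \<Longrightarrow> leaf_set (restrict_tree A t) = leaf_set t \<inter> A"
  by (induction t) (auto simp: Int_Un_distrib2)

lemma restrict_tree_subset: "set (leaves (restrict_tree A t)) \<subseteq> set (leaves t)"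
  by (induction t) auto

lemma restrict_tree_distinct: "distinct (leaves t) \<Longrightarrow> distinct (leaves (restrict_tree A t))"
proof (induction t)
  case (Leaf x)
  then show ?case by simp
next
  case (Node u d)
  then show ?case
    using restrict_tree_subset[of A u] restrict_tree_subset[of A d] by auto
qed

section \<open>Layouts\<close>

datatype layout =
  Layout (left_tree: "nat ptree") (right_tree: "nat ptree") (matching: "(nat \<times> nat) set")

definition is_layout :: "layout \<Rightarrow> bool" where
  "is_layout X \<longleftrightarrow>
     distinct (leaves (left_tree X)) \<and> distinct (leaves (right_tree X)) \<and>
     matching X \<subseteq> leaf_set (left_tree X) \<times> leaf_set (right_tree X) \<and>
     (\<forall>x \<in> leaf_set (left_tree X). \<exists>!y. (x, y) \<in> matching X) \<and>
     (\<forall>y \<in> leaf_set (right_tree X). \<exists>!x. (x, y) \<in> matching X)"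

text \<open>Two straight segments between the two vertical lines cross iff their end points occur
  in opposite orders on the two lines.\<close>

definition crossing :: "layout \<Rightarrow> nat \<times> nat \<Rightarrow> nat \<times> nat \<Rightarrow> bool" where
  "crossing X e f \<longleftrightarrow>
     (above (left_tree X) (fst e) (fst f) \<and> above (right_tree X) (snd f) (snd e)) \<or>
     (above (left_tree X) (fst f) (fst e) \<and> above (right_tree X) (snd e) (snd f))"

inductive switch :: "layout \<Rightarrow> layout \<Rightarrow> bool" where
  left: "switch_tree L L' \<Longrightarrow> switch (Layout L R M) (Layout L' R M)"
| right: "switch_tree R R' \<Longrightarrow> switch (Layout L R M) (Layout L R' M)"

fun rename :: "(nat \<Rightarrow> nat) \<Rightarrow> (nat \<Rightarrow> nat) \<Rightarrow> layout \<Rightarrow> layout" where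
  "rename f g (Layout L R M) = Layout (map_ptree f L) (map_ptree g R) (map_prod f g ` M)"

fun induced_layout :: "layout \<Rightarrow> (nat \<times> nat) set \<Rightarrow> layout" where
  "induced_layout (Layout L R M) E =
     Layout (restrict_tree (fst ` E) L) (restrict_tree (snd ` E) R) E"

lemma induced_layout_is_layout:
  assumes "is_layout X" "E \<subseteq> matching X" "E \<noteq> {}"
  shows "is_layout (induced_layout X E)"
proof (cases X)
  case (Layout L R M)
  have "fst ` E \<subseteq> leaf_set L" "snd ` E \<subseteq> leaf_set R"
    using assms Layout by (auto simp: is_layout_def)
  then have l: "leaf_set (restrict_tree (fst ` E) L) = fst ` E"
    and r: "leaf_set (restrict_tree (snd ` E) R) = snd ` E"
    using assms(3) restrict_tree_leaf_set[of L "fst ` E"] restrict_tree_leaf_set[of R "snd ` E"]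
    by blast+
  have M: "\<And>x y. (x, y) \<in> E \<Longrightarrow> (x, y) \<in> M" 
    using assms Layout by auto
  have u1: "y = y'" if "(x, y) \<in> M" "(x, y') \<in> M" for x y y'
  proof -
    have "x \<in> leaf_set L" using that assms Layout by (auto simp: is_layout_def)
    then show ?thesis using that assms(1) Layout unfolding is_layout_def by auto
  qed
  have u2: "x = x'" if "(x, y) \<in> M" "(x', y) \<in> M" for x x' y
  proof -
    have "y \<in> leaf_set R" using that assms Layout by (auto simp: is_layout_def)
    then show ?thesis using that assms(1) Layout unfolding is_layout_def by auto
  qed
  have "E \<subseteq> fst ` E \<times> snd ` E" by force
  moreover have "\<forall>x \<in> fst ` E. \<exists>!y. (x, y) \<in> E"
  proof
    fix x assume "x \<in> fst ` E"
    then obtain y where y: "(x, y) \<in> E" by auto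
    show "\<exists>!y. (x, y) \<in> E"
      by (rule ex1I[of _ y]) (use y M u1 in blast)+
  qed
  moreover have "\<forall>y \<in> snd ` E. \<exists>!x. (x, y) \<in> E"
  proof
    fix y assume "y \<in> snd ` E"
    then obtain x where x: "(x, y) \<in> E" by auto
    show "\<exists>!x. (x, y) \<in> E"
      by (rule ex1I[of _ x]) (use x M u2 in blast)+
  qed
  ultimately show ?thesis
    using assms(1) Layout unfolding is_layout_def
    by (simp only: induced_layout.simps layout.sel l r restrict_tree_distinct simp_thms)
qed

text \<open>Equality of tanglegrams: a sequence of switches, and a change of leaf names.\<close>

definition layout_equiv :: "layout \<Rightarrow> layout \<Rightarrow> bool" where
  "layout_equiv X Y \<longleftrightarrow> is_layout X \<and> is_layout Y \<and>
     (\<exists>Z f g. switch\<^sup>*\<^sup>* X Z \<and>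
        inj_on f (leaf_set (left_tree Z)) \<and> inj_on g (leaf_set (right_tree Z)) \<and>
        Y = rename f g Z)"

lemma switch_sym: "switch X Y \<Longrightarrow> switch Y X"
  by (auto elim!: switch.cases intro: switch.intros switch_tree_sym)

lemma switch_rename: "switch X Y \<Longrightarrow> switch (rename f g X) (rename f g Y)"
  by (erule switch.cases) (simp_all add: switch.intros switch_tree_map)

lemma switches_sym: "switch\<^sup>*\<^sup>* X Y \<Longrightarrow> switch\<^sup>*\<^sup>* Y X"
  by (induction rule: rtranclp_induct) (auto intro: switch_sym converse_rtranclp_into_rtranclp)

lemma switches_rename: "switch\<^sup>*\<^sup>* X Y \<Longrightarrow> switch\<^sup>*\<^sup>* (rename f g X) (rename f g Y)"
  by (induction rule: rtranclp_induct) (auto intro: switch_rename rtranclp.rtrancl_into_rtrancl)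

lemma switches_leaf_sets:
  "switch\<^sup>*\<^sup>* X Y \<Longrightarrow> leaf_set (left_tree Y) = leaf_set (left_tree X) \<and>
     leaf_set (right_tree Y) = leaf_set (right_tree X) \<and> matching Y = matching X"
  by (induction rule: rtranclp_induct) (auto elim!: switch.cases dest: switch_tree_leaf_set)

lemma switches_is_layout: "switch\<^sup>*\<^sup>* X Y \<Longrightarrow> is_layout X \<Longrightarrow> is_layout Y"
proof (induction rule: rtranclp_induct)
  case base
  then show ?case .
next
  case (step Y Z)
  then have "is_layout Y" by simp
  with step(2) show ?case
    by (cases; simp add: is_layout_def switch_tree_leaf_set switch_tree_distinct)
qed

lemma rename_leaf_sets:
  "leaf_set (left_tree (rename f g X)) = f ` leaf_set (left_tree X)"
  "leaf_set (right_tree (rename f g X)) = g ` leaf_set (right_tree X)"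
  by (cases X; simp add: ptree.set_map)+

lemma rename_rename: "rename f' g' (rename f g X) = rename (f' \<circ> f) (g' \<circ> g) X"
  by (cases X) (simp add: ptree.map_comp map_prod.comp image_comp)

lemma rename_id:
  assumes "is_layout X"
    and "\<And>x. x \<in> leaf_set (left_tree X) \<Longrightarrow> f x = x"
    and "\<And>y. y \<in> leaf_set (right_tree X) \<Longrightarrow> g y = y"
  shows "rename f g X = X"
proof (cases X)
  case (Layout L R M)
  have "map_ptree f L = L" "map_ptree g R = R"
    using assms Layout by (auto intro: ptree.map_ident_strong)
  moreover have "map_prod f g e = e" if "e \<in> M" for e
    using that assms Layout by (cases e) (auto simp: is_layout_def)
  then have "map_prod f g ` M = M" by force
  ultimately show ?thesis using Layout by simp
qed

lemma layout_equiv_refl: "is_layout X \<Longrightarrow> layout_equiv X X"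
  unfolding layout_equiv_def
  by (intro conjI exI[of _ X] exI[of _ id]) (auto simp: rename_id)

lemma layout_equiv_sym:
  assumes "layout_equiv X Y" shows "layout_equiv Y X"
proof -
  from assms obtain Z f g where *: "is_layout X" "is_layout Y" "switch\<^sup>*\<^sup>* X Z"
    "inj_on f (leaf_set (left_tree Z))" "inj_on g (leaf_set (right_tree Z))" "Y = rename f g Z"
    unfolding layout_equiv_def by blast
  let ?W = "rename f g X"
  let ?f = "inv_into (leaf_set (left_tree X)) f" and ?g = "inv_into (leaf_set (right_tree X)) g"
  note ls = switches_leaf_sets[OF *(3)]
  have "switch\<^sup>*\<^sup>* Y ?W"
    unfolding *(6) by (rule switches_rename[OF switches_sym[OF *(3)]])
  moreover have "rename ?f ?g ?W = X"
    unfolding rename_rename using * ls by (intro rename_id) auto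
  moreover have "inj_on ?f (leaf_set (left_tree ?W))" "inj_on ?g (leaf_set (right_tree ?W))"
    by (simp_all add: rename_leaf_sets inj_on_inv_into)
  ultimately show ?thesis
    using * unfolding layout_equiv_def by metis
qed

lemma layout_equiv_trans:
  assumes "layout_equiv X Y" "layout_equiv Y V" shows "layout_equiv X V"
proof -
  from assms(1) obtain Z f g where 1: "is_layout X" "is_layout Y" "switch\<^sup>*\<^sup>* X Z"
    "inj_on f (leaf_set (left_tree Z))" "inj_on g (leaf_set (right_tree Z))" "Y = rename f g Z"
    unfolding layout_equiv_def by blast
  from assms(2) obtain W f' g' where 2: "is_layout V" "switch\<^sup>*\<^sup>* Y W"
    "inj_on f' (leaf_set (left_tree W))" "inj_on g' (leaf_set (right_tree W))"
    "V = rename f' g' W"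
    unfolding layout_equiv_def by blast
  let ?f = "inv_into (leaf_set (left_tree Z)) f" and ?g = "inv_into (leaf_set (right_tree Z)) g"
  let ?U = "rename ?f ?g W"
  have Z: "is_layout Z" using switches_is_layout 1 by blast
  have W: "is_layout W" using switches_is_layout 1 2 by blast
  have lW: "leaf_set (left_tree W) = f ` leaf_set (left_tree Z)"
    "leaf_set (right_tree W) = g ` leaf_set (right_tree Z)"
    using switches_leaf_sets[OF 2(2)] by (simp_all add: 1(6) rename_leaf_sets)
  have "rename ?f ?g Y = Z"
    unfolding 1(6) rename_rename using 1 Z by (intro rename_id) auto
  then have "switch\<^sup>*\<^sup>* X ?U"
    using switches_rename[OF 2(2), of ?f ?g] 1(3) by simp
  moreover have "rename f g ?U = W"
    unfolding rename_rename using W lW by (intro rename_id) (auto simp: f_inv_into_f)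
  then have "V = rename (f' \<circ> f) (g' \<circ> g) ?U"
    unfolding 2(5) by (simp add: rename_rename[symmetric])
  moreover have "leaf_set (left_tree ?U) = leaf_set (left_tree Z)"
    "leaf_set (right_tree ?U) = leaf_set (right_tree Z)"
    using 1 by (simp_all add: rename_leaf_sets lW)
  then have "inj_on (f' \<circ> f) (leaf_set (left_tree ?U))"
    "inj_on (g' \<circ> g) (leaf_set (right_tree ?U))"
    using 1 2 lW by (simp_all add: comp_inj_on)
  ultimately show ?thesis
    using 1 2 unfolding layout_equiv_def by blast
qed

section \<open>Tanglegrams\<close>

quotient_type tanglegram = layout / partial: layout_equiv
proof (rule part_equivpI)
  have "is_layout (Layout (Leaf 0) (Leaf 0) {(0, 0)})" by (simp add: is_layout_def)
  then show "\<exists>X. layout_equiv X X" using layout_equiv_refl by blast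
  show "symp layout_equiv" by (blast intro: sympI layout_equiv_sym)
  show "transp layout_equiv" by (blast intro: transpI layout_equiv_trans)
qed

definition layout_of :: "layout \<Rightarrow> tanglegram \<Rightarrow> bool" where
  "layout_of X T \<longleftrightarrow> is_layout X \<and> abs_tanglegram X = T"

definition planar :: "tanglegram \<Rightarrow> bool" where
  "planar T \<longleftrightarrow>
     (\<exists>X. layout_of X T \<and> (\<forall>e \<in> matching X. \<forall>f \<in> matching X. \<not> crossing X e f))"

definition induced_subtanglegram :: "tanglegram \<Rightarrow> tanglegram \<Rightarrow> bool" where
  "induced_subtanglegram S T \<longleftrightarrow>
     (\<exists>X E. layout_of X T \<and> E \<subseteq> matching X \<and> E \<noteq> {} \<and> S = abs_tanglegram (induced_layout X E))"

definition proper_induced_subtanglegram :: "tanglegram \<Rightarrow> tanglegram \<Rightarrow> bool" where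
  "proper_induced_subtanglegram S T \<longleftrightarrow>
     (\<exists>X E. layout_of X T \<and> E \<subset> matching X \<and> E \<noteq> {} \<and> S = abs_tanglegram (induced_layout X E))"

definition crossing_critical :: "tanglegram \<Rightarrow> bool" where
  "crossing_critical T \<longleftrightarrow>
     \<not> planar T \<and> (\<forall>S. proper_induced_subtanglegram S T \<longrightarrow> planar S)"

text \<open>The tanglegram of two trees with the same leaf labels, equal labels being matched.\<close>

definition tanglegram_of :: "nat ptree \<Rightarrow> nat ptree \<Rightarrow> tanglegram" where
  "tanglegram_of L R = abs_tanglegram (Layout L R (Id_on (leaf_set L)))"

text \<open>The labels \<open>a\<close>, \<open>b\<close>, \<open>c\<close>, \<open>d\<close> are \<open>0\<close>, \<open>1\<close>, \<open>2\<close>, \<open>3\<close>.\<close>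

definition T1 :: tanglegram where
  "T1 = tanglegram_of
     (Node (Node (Node (Leaf 0) (Leaf 1)) (Leaf 2)) (Leaf 3))
     (Node (Node (Node (Leaf 0) (Leaf 3)) (Leaf 2)) (Leaf 1))"

definition T2 :: tanglegram where
  "T2 = tanglegram_of
     (Node (Node (Leaf 0) (Leaf 1)) (Node (Leaf 2) (Leaf 3)))
     (Node (Node (Leaf 0) (Leaf 2)) (Node (Leaf 1) (Leaf 3)))"

lemma tanglegram_of_is_layout:
  assumes "distinct (leaves L)" "distinct (leaves R)" "leaf_set L = leaf_set R"
  shows "is_layout (Layout L R (Id_on (leaf_set L)))"
  using assms by (auto simp: is_layout_def)

lemma abs_tanglegram_eq_iff:
  assumes "is_layout X" "is_layout Y"
  shows "abs_tanglegram X = abs_tanglegram Y \<longleftrightarrow> layout_equiv X Y"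
  using Quotient_rel[OF Quotient_tanglegram, of X Y] assms layout_equiv_refl by blast

end

theory Submission
  imports Defs
begin

text \<open>
  Relabel so that equal leaves are matched. A tanglegram is then planar iff its two trees admit a common leaf
  order. Such an order is built top-down: keep, for each tree, a list of disjoint subtrees obtained by cutting
  at vertices, such that the two lists never order two leaves in opposite ways. A subtree \<open>Node P
  Q\<close> of one list that is not contained in a subtree of the other is cut next, as is a tree that is still
  whole. If neither \<open>P, Q\<close> nor \<open>Q, P\<close> keeps the lists consistent, then either both
  parts meet the same two subtrees of the other list, which gives \<open>T\<^sub>2\<close>, or leaves of the two
  parts alternate \<open>p, q, r\<close> in the other list. In the latter case the invariant
  \<open>anchored\<close> supplies a leaf \<open>w\<close> that together with \<open>p, q, r\<close> gives
  \<open>T\<^sub>1\<close>. When no cut is left, the two lists consist of subtrees with the same leaf sets in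
  the same order, and induction on the size finishes.
\<close>

section \<open>Rooted trees up to switches, described by the leaf sets of their subtrees\<close>

section \<open>Clusters\<close>

text \<open>The clusters of phylogenetics, one leaf set per vertex. They forget the up/down order
  and so are invariant under switches; the shape of a tree is always accessed through them.\<close>

fun clusters :: "'a ptree \<Rightarrow> 'a set set" where
  "clusters (Leaf x) = {{x}}"
| "clusters (Node u d) = insert (leaf_set u \<union> leaf_set d) (clusters u \<union> clusters d)"

lemma leaf_set_nonempty: "leaf_set t \<noteq> {}"
  by (induction t) auto

lemma finite_leaf_set: "finite (leaf_set t)"
  by (induction t) auto

lemma leaf_set_in_clusters: "leaf_set t \<in> clusters t"
  by (cases t) auto

lemma clusters_subset: "C \<in> clusters t \<Longrightarrow> C \<subseteq> leaf_set t"
  by (induction t) auto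

lemma clusters_nonempty: "C \<in> clusters t \<Longrightarrow> C \<noteq> {}"
  by (induction t) (auto simp: leaf_set_nonempty)

lemma singleton_in_clusters: "x \<in> leaf_set t \<Longrightarrow> {x} \<in> clusters t"
  by (induction t) auto

lemma clusters_switch_tree: "switch_tree s t \<Longrightarrow> clusters t = clusters s"
  by (induction rule: switch_tree.induct) (auto dest: switch_tree_leaf_set)

lemma clusters_switches: "switch_tree\<^sup>*\<^sup>* s t \<Longrightarrow> clusters t = clusters s"
  by (induction rule: rtranclp_induct) (auto dest: clusters_switch_tree)

text \<open>A vertex with leaves in \<open>A\<close> survives the restriction or is replaced by a
  descendant with the same leaves in \<open>A\<close>; in both cases its trace on \<open>A\<close>
  is the leaf set of a subtree.\<close>

lemma clusters_restrict_tree: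
  "C \<in> clusters t \<Longrightarrow> C \<inter> A \<noteq> {} \<Longrightarrow> C \<inter> A \<in> clusters (restrict_tree A t)"
proof (induction t)
  case (Leaf x)
  then show ?case by auto
next
  case (Node u d)
  show ?case
  proof (cases "C = leaf_set u \<union> leaf_set d")
    case True
    have "leaf_set (Node u d) \<inter> A \<noteq> {}" using Node.prems(2) True by simp
    from restrict_tree_leaf_set[OF this] show ?thesis
      using leaf_set_in_clusters[of "restrict_tree A (Node u d)"] True by simp
  next
    case False
    then show ?thesis
      using Node clusters_subset[of C u] clusters_subset[of C d] by auto
  qed
qed

lemma switches_leaf_set: "switch_tree\<^sup>*\<^sup>* s t \<Longrightarrow> leaf_set t = leaf_set s"
  by (induction rule: rtranclp_induct) (auto dest: switch_tree_leaf_set)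

lemma switches_distinct: "switch_tree\<^sup>*\<^sup>* s t \<Longrightarrow> distinct (leaves t) = distinct (leaves s)"
  by (induction rule: rtranclp_induct) (auto dest: switch_tree_distinct)

lemma switches_Node:
  assumes "switch_tree\<^sup>*\<^sup>* u u'" "switch_tree\<^sup>*\<^sup>* d d'"
  shows "switch_tree\<^sup>*\<^sup>* (Node u d) (Node u' d')"
proof -
  have "switch_tree\<^sup>*\<^sup>* (Node u d) (Node u' d)"
    using assms(1)
    by (induction rule: rtranclp_induct) (blast intro: rtranclp.rtrancl_into_rtrancl switch_tree.up)+
  moreover have "switch_tree\<^sup>*\<^sup>* (Node u' d) (Node u' d')"
    using assms(2)
    by (induction rule: rtranclp_induct) (blast intro: rtranclp.rtrancl_into_rtrancl switch_tree.down)+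
  ultimately show ?thesis by simp
qed

lemma switches_Node_swap:
  assumes "switch_tree\<^sup>*\<^sup>* u u'" "switch_tree\<^sup>*\<^sup>* d d'"
  shows "switch_tree\<^sup>*\<^sup>* (Node u d) (Node d' u')"
  using switches_Node[OF assms] switch_tree.here[of u' d']
  by (rule rtranclp.rtrancl_into_rtrancl)

lemma leaf_set_singleton_imp_Leaf:
  assumes "distinct (leaves t)" "leaf_set t = {x}"
  shows "t = Leaf x"
proof (cases t)
  case (Node u d)
  then have "leaf_set u \<subseteq> {x}" "leaf_set d \<subseteq> {x}" "leaf_set u \<inter> leaf_set d = {}"
    using assms by (auto simp: set_leaves)
  then show ?thesis using leaf_set_nonempty[of u] leaf_set_nonempty[of d] by blast
qed (use assms in auto)

lemma clusters_of_subset: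
  assumes "distinct (leaves (Node u d))" "C \<in> clusters (Node u d)" "C \<subseteq> leaf_set u"
  shows "C \<in> clusters u"
  using assms clusters_subset[of C d] clusters_nonempty[of C d] leaf_set_nonempty[of d]
    leaf_set_in_clusters[of u]
  by (auto simp: set_leaves)

lemma clusters_of_subset':
  assumes "distinct (leaves (Node u d))" "C \<in> clusters (Node u d)" "C \<subseteq> leaf_set d"
  shows "C \<in> clusters d"
  using assms clusters_of_subset[of d u C] by (auto simp: set_leaves Un_commute Int_commute)

text \<open>The leaf sets of the children of \<open>s\<close> are proper clusters of
  \<open>t\<close>, so each lies below a child of \<open>t\<close>; since they partition the leaves,
  they are the leaf sets of the children of \<open>t\<close> up to a swap, and induction handles
  each side. Since inclusion of clusters suffices, the shape of a small tree can be recognised from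
  a few traces.\<close>

lemma switches_if_clusters_subset:
  assumes "distinct (leaves s)" "distinct (leaves t)" "leaf_set s = leaf_set t"
    and "clusters s \<subseteq> clusters t"
  shows "switch_tree\<^sup>*\<^sup>* s t"
  using assms
proof (induction s arbitrary: t)
  case (Leaf x)
  then show ?case using leaf_set_singleton_imp_Leaf[of t x] by simp
next
  case (Node u d)
  have u: "distinct (leaves u)" and d: "distinct (leaves d)"
    and disj: "leaf_set u \<inter> leaf_set d = {}"
    using Node.prems(1) by (auto simp: set_leaves)
  obtain v e where t: "t = Node v e"
  proof (cases t)
    case (Leaf y)
    then have "leaf_set u \<subseteq> {y}" "leaf_set d \<subseteq> {y}" using Node.prems(3) by auto
    then show ?thesis using disj leaf_set_nonempty[of u] leaf_set_nonempty[of d] by blast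
  qed
  have disj': "leaf_set v \<inter> leaf_set e = {}" and v: "distinct (leaves v)" and e: "distinct (leaves e)"
    using Node.prems(2) t by (auto simp: set_leaves)
  have eq: "leaf_set u \<union> leaf_set d = leaf_set v \<union> leaf_set e"
    using Node.prems(3) t by simp
  have sub: "C \<subseteq> leaf_set v \<or> C \<subseteq> leaf_set e" if "C \<in> clusters t" "C \<noteq> leaf_set t" for C
    using that clusters_subset[of C v] clusters_subset[of C e] by (auto simp: t)
  have v_part: "clusters w \<subseteq> clusters v"
    if "clusters w \<subseteq> clusters t" "leaf_set w = leaf_set v" for w
    using that clusters_of_subset[OF Node.prems(2)[unfolded t]] clusters_subset[of _ w]
    unfolding t by blast
  have e_part: "clusters w \<subseteq> clusters e"
    if "clusters w \<subseteq> clusters t" "leaf_set w = leaf_set e" for w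
    using that clusters_of_subset'[OF Node.prems(2)[unfolded t]] clusters_subset[of _ w]
    unfolding t by blast
  have cl: "clusters u \<subseteq> clusters t" "clusters d \<subseteq> clusters t"
    using Node.prems(4) by auto
  have "leaf_set u \<in> clusters t" "leaf_set d \<in> clusters t"
    using Node.prems(4) leaf_set_in_clusters[of u] leaf_set_in_clusters[of d] by auto
  moreover have "leaf_set u \<noteq> leaf_set t" "leaf_set d \<noteq> leaf_set t"
    using Node.prems(3) disj leaf_set_nonempty[of u] leaf_set_nonempty[of d] by auto
  moreover have "\<not> leaf_set v \<union> leaf_set e \<subseteq> leaf_set v" "\<not> leaf_set v \<union> leaf_set e \<subseteq> leaf_set e"
    using disj' leaf_set_nonempty[of v] leaf_set_nonempty[of e] by auto
  \<comment> \<open>Both children of \<open>s\<close> cannot lie below the same child of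
    \<open>t\<close>, because their union is the full leaf set.\<close>
  ultimately consider "leaf_set u \<subseteq> leaf_set v" "leaf_set d \<subseteq> leaf_set e"
    | "leaf_set u \<subseteq> leaf_set e" "leaf_set d \<subseteq> leaf_set v"
    using sub eq by (metis Un_least)
  then consider "leaf_set u = leaf_set v" "leaf_set d = leaf_set e"
    | "leaf_set u = leaf_set e" "leaf_set d = leaf_set v"
    by cases (use eq disj' in auto)
  then show ?case
  proof cases
    case 1
    then show ?thesis
      unfolding t using Node.IH(1)[of v] Node.IH(2)[of e] u d v e v_part e_part cl
      by (intro switches_Node) blast+
  next
    case 2
    then show ?thesis
      unfolding t using Node.IH(1)[of e] Node.IH(2)[of v] u d v e v_part e_part cl
      by (intro switches_Node_swap) blast+
  qed
qed

section \<open>Four-leaf patterns that exclude a planar drawing\<close>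

section \<open>Obstructions\<close>

text \<open>For distinct leaves of \<open>t\<close>, the traces \<open>{a, b}\<close> and
  \<open>{a, b, c}\<close> pin down the induced four-leaf tree as (((a,b),c),d) up to switches,
  without computing a restricted tree.\<close>

definition caterpillar :: "'a ptree \<Rightarrow> 'a \<Rightarrow> 'a \<Rightarrow> 'a \<Rightarrow> 'a \<Rightarrow> bool" where
  "caterpillar t a b c d \<longleftrightarrow> (\<exists>C \<in> clusters t. \<exists>D \<in> clusters t.
     C \<inter> {a, b, c, d} = {a, b} \<and> D \<inter> {a, b, c, d} = {a, b, c})"

text \<open>In the same way the two traces encode the shape ((a,b),(c,d)).\<close>

definition balanced :: "'a ptree \<Rightarrow> 'a \<Rightarrow> 'a \<Rightarrow> 'a \<Rightarrow> 'a \<Rightarrow> bool" where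
  "balanced t a b c d \<longleftrightarrow> (\<exists>C \<in> clusters t. \<exists>D \<in> clusters t.
     C \<inter> {a, b, c, d} = {a, b} \<and> D \<inter> {a, b, c, d} = {c, d})"

text \<open>The label patterns are those of \<open>T1\<close> and \<open>T2\<close>: for trees on
  the same distinct leaves, with equal names matched, one of the two is induced by four matching
  edges.\<close>

definition obstructed :: "'a ptree \<Rightarrow> 'a ptree \<Rightarrow> bool" where
  "obstructed L R \<longleftrightarrow> (\<exists>a b c d. distinct [a, b, c, d] \<and> {a, b, c, d} \<subseteq> leaf_set L \<and>
     (caterpillar L a b c d \<and> caterpillar R a d c b \<or>
      balanced L a b c d \<and> balanced R a c b d))"

lemma caterpillarI:
  "C \<in> clusters t \<Longrightarrow> D \<in> clusters t \<Longrightarrow> a \<in> C \<Longrightarrow> b \<in> C \<Longrightarrow> c \<notin> C \<Longrightarrow> d \<notin> C \<Longrightarrow>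
     a \<in> D \<Longrightarrow> b \<in> D \<Longrightarrow> c \<in> D \<Longrightarrow> d \<notin> D \<Longrightarrow> caterpillar t a b c d"
  unfolding caterpillar_def by (intro bexI[of _ C] bexI[of _ D]) auto

lemma balancedI:
  "C \<in> clusters t \<Longrightarrow> D \<in> clusters t \<Longrightarrow> a \<in> C \<Longrightarrow> b \<in> C \<Longrightarrow> c \<notin> C \<Longrightarrow> d \<notin> C \<Longrightarrow>
     a \<notin> D \<Longrightarrow> b \<notin> D \<Longrightarrow> c \<in> D \<Longrightarrow> d \<in> D \<Longrightarrow> balanced t a b c d"
  unfolding balanced_def by (intro bexI[of _ C] bexI[of _ D]) auto

lemma caterpillarE:
  assumes "caterpillar t a b c d" "distinct [a, b, c, d]"
  obtains C D where "C \<in> clusters t" "D \<in> clusters t" "{a, b} \<subseteq> C" "{c, d} \<inter> C = {}"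
    "{a, b, c} \<subseteq> D" "d \<notin> D"
proof -
  obtain C D where CD: "C \<in> clusters t" "D \<in> clusters t"
    "C \<inter> {a, b, c, d} = {a, b}" "D \<inter> {a, b, c, d} = {a, b, c}"
    using assms(1) unfolding caterpillar_def by blast
  have "x \<in> C \<longleftrightarrow> x \<in> {a, b}" "x \<in> D \<longleftrightarrow> x \<in> {a, b, c}" if "x \<in> {a, b, c, d}" for x
    using that CD(3,4) by blast+
  then show ?thesis using assms(2) CD(1,2) by (intro that[of C D]) auto
qed

lemma balancedE:
  assumes "balanced t a b c d" "distinct [a, b, c, d]"
  obtains C D where "C \<in> clusters t" "D \<in> clusters t" "{a, b} \<subseteq> C" "{c, d} \<inter> C = {}"
    "{c, d} \<subseteq> D" "{a, b} \<inter> D = {}"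
proof -
  obtain C D where CD: "C \<in> clusters t" "D \<in> clusters t"
    "C \<inter> {a, b, c, d} = {a, b}" "D \<inter> {a, b, c, d} = {c, d}"
    using assms(1) unfolding balanced_def by blast
  have "x \<in> C \<longleftrightarrow> x \<in> {a, b}" "x \<in> D \<longleftrightarrow> x \<in> {c, d}" if "x \<in> {a, b, c, d}" for x
    using that CD(3,4) by blast+
  then show ?thesis using assms(2) CD(1,2) by (intro that[of C D]) auto
qed

lemma caterpillar_mono:
  "caterpillar t a b c d \<Longrightarrow> clusters t \<subseteq> clusters t' \<Longrightarrow> caterpillar t' a b c d"
  unfolding caterpillar_def by (meson subsetD)

lemma balanced_mono:
  "balanced t a b c d \<Longrightarrow> clusters t \<subseteq> clusters t' \<Longrightarrow> balanced t' a b c d"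
  unfolding balanced_def by (meson subsetD)

lemma caterpillar_commute: "caterpillar t a b c d \<longleftrightarrow> caterpillar t b a c d"
  by (simp add: caterpillar_def insert_commute)

lemma obstructedE:
  assumes "obstructed L R"
  obtains (caterpillars) a b c d where "distinct [a, b, c, d]" "{a, b, c, d} \<subseteq> leaf_set L"
      "caterpillar L a b c d" "caterpillar R a d c b"
  | (balanced) a b c d where "distinct [a, b, c, d]" "{a, b, c, d} \<subseteq> leaf_set L"
      "balanced L a b c d" "balanced R a c b d"
  using assms unfolding obstructed_def by (elim exE conjE disjE) metis+

lemma obstructedI_caterpillars:
  "distinct [a, b, c, d] \<Longrightarrow> {a, b, c, d} \<subseteq> leaf_set L \<Longrightarrow>
     caterpillar L a b c d \<Longrightarrow> caterpillar R a d c b \<Longrightarrow> obstructed L R"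
  unfolding obstructed_def by (intro exI conjI disjI1)

lemma obstructedI_balanced:
  "distinct [a, b, c, d] \<Longrightarrow> {a, b, c, d} \<subseteq> leaf_set L \<Longrightarrow>
     balanced L a b c d \<Longrightarrow> balanced R a c b d \<Longrightarrow> obstructed L R"
  unfolding obstructed_def by (intro exI conjI disjI2)

text \<open>Exchanging the trees amounts to exchanging \<open>b\<close> and \<open>d\<close> in the
  pattern of \<open>T1\<close>, and \<open>b\<close> and \<open>c\<close> in that of
  \<open>T2\<close>.\<close>

lemma obstructed_sym:
  assumes "obstructed L R" "leaf_set L = leaf_set R"
  shows "obstructed R L"
  using assms(1)
proof (cases rule: obstructedE)
  case (caterpillars a b c d)
  then show ?thesis using assms(2) by (intro obstructedI_caterpillars[of a d c b]) auto
next
  case (balanced a b c d)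
  then show ?thesis using assms(2) by (intro obstructedI_balanced[of a c b d]) auto
qed

text \<open>Serves for switched trees, which have the same clusters, and for blocks of a dissection,
  whose clusters are among those of the whole tree.\<close>

lemma obstructed_mono:
  assumes "obstructed L R" "clusters L \<subseteq> clusters L'" "clusters R \<subseteq> clusters R'"
  shows "obstructed L' R'"
proof -
  have sub: "leaf_set L \<subseteq> leaf_set L'"
    using assms(2) leaf_set_in_clusters[of L] clusters_subset by blast
  show ?thesis
    using assms(1)
  proof (cases rule: obstructedE)
    case (caterpillars a b c d)
    moreover have "caterpillar L' a b c d" "caterpillar R' a d c b"
      using caterpillars(3,4) assms(2,3) caterpillar_mono by metis+
    ultimately show ?thesis using sub by (intro obstructedI_caterpillars[of a b c d]) auto
  next
    case (balanced a b c d)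
    moreover have "balanced L' a b c d" "balanced R' a c b d"
      using balanced(3,4) assms(2,3) balanced_mono by metis+
    ultimately show ?thesis using sub by (intro obstructedI_balanced[of a b c d]) auto
  qed
qed

section \<open>Ordered forests obtained by cutting a tree from the root\<close>

section \<open>Dissections\<close>

text \<open>A partially decided drawing: the order of the blocks is fixed, while the inside of each
  block is still free. The rule \<open>split_swap\<close> combines a cut with a switch at the vertex
  cut.\<close>

inductive dissection :: "'a ptree \<Rightarrow> 'a ptree list \<Rightarrow> bool" for t where
  whole: "dissection t [t]"
| split: "dissection t (us @ Node u d # vs) \<Longrightarrow> dissection t (us @ u # d # vs)"
| split_swap: "dissection t (us @ Node u d # vs) \<Longrightarrow> dissection t (us @ d # u # vs)"

abbreviation forest_leaves :: "'a ptree list \<Rightarrow> 'a set" where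
  "forest_leaves ts \<equiv> (\<Union>t \<in> set ts. leaf_set t)"

lemma dissection_leaves: "dissection t ts \<Longrightarrow> forest_leaves ts = leaf_set t"
  by (induction rule: dissection.induct) auto

lemma dissection_distinct:
  "dissection t ts \<Longrightarrow> distinct (leaves t) \<Longrightarrow> distinct (concat (map leaves ts))"
  by (induction rule: dissection.induct) (auto simp: set_leaves)

lemma dissection_clusters: "dissection t ts \<Longrightarrow> x \<in> set ts \<Longrightarrow> clusters x \<subseteq> clusters t"
  by (induction arbitrary: x rule: dissection.induct) fastforce+

text \<open>Cutting preserves the total number of leaves and every block has at least one, so the
  number of cuts is bounded.\<close>

lemma dissection_length:
  assumes "dissection t ts" shows "length ts \<le> length (leaves t)"
proof -
  have "length (concat (map leaves ts)) = length (leaves t)"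
    using assms by (induction rule: dissection.induct) auto
  moreover have pos: "1 \<le> length (leaves x)" for x :: "'a ptree"
    by (induction x) auto
  have "length ts \<le> length (concat (map leaves ts))"
  proof (induction ts)
    case (Cons x ts)
    then show ?case using pos[of x] by simp
  qed simp
  ultimately show ?thesis by simp
qed

text \<open>Reassembly: undoing the cuts in reverse order makes adjacent pieces children of one
  vertex again, swapped if the cut was a \<open>split_swap\<close>.\<close>

lemma dissection_switches:
  assumes "dissection t ts" "list_all2 switch_tree\<^sup>*\<^sup>* ts ss"
  shows "\<exists>s. switch_tree\<^sup>*\<^sup>* t s \<and> leaves s = concat (map leaves ss)"
  using assms
proof (induction arbitrary: ss rule: dissection.induct)
  case whole
  then show ?case by (auto simp: list_all2_Cons1)
next
  case (split us u d vs)
  then obtain us' u' d' vs' where ss: "ss = us' @ u' # d' # vs'"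
    "list_all2 switch_tree\<^sup>*\<^sup>* us us'" "switch_tree\<^sup>*\<^sup>* u u'" "switch_tree\<^sup>*\<^sup>* d d'"
    "list_all2 switch_tree\<^sup>*\<^sup>* vs vs'"
    by (auto simp: list_all2_append1 list_all2_Cons1)
  then have "list_all2 switch_tree\<^sup>*\<^sup>* (us @ Node u d # vs) (us' @ Node u' d' # vs')"
    by (auto intro!: list_all2_appendI switches_Node)
  from split.IH[OF this] show ?case by (simp add: ss)
next
  case (split_swap us u d vs)
  then obtain us' u' d' vs' where ss: "ss = us' @ d' # u' # vs'"
    "list_all2 switch_tree\<^sup>*\<^sup>* us us'" "switch_tree\<^sup>*\<^sup>* u u'" "switch_tree\<^sup>*\<^sup>* d d'"
    "list_all2 switch_tree\<^sup>*\<^sup>* vs vs'"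
    by (auto simp: list_all2_append1 list_all2_Cons1)
  then have "list_all2 switch_tree\<^sup>*\<^sup>* (us @ Node u d # vs) (us' @ Node d' u' # vs')"
    by (auto intro!: list_all2_appendI switches_Node_swap)
  from split_swap.IH[OF this] show ?case by (simp add: ss)
qed

text \<open>The part of the leaf order that a dissection has already fixed. If all leaves are
  distinct, two leaves of one block are incomparable.\<close>

fun before :: "'a ptree list \<Rightarrow> 'a \<Rightarrow> 'a \<Rightarrow> bool" where
  "before [] x y \<longleftrightarrow> False"
| "before (t # ts) x y \<longleftrightarrow> x \<in> leaf_set t \<and> y \<in> forest_leaves ts \<or> before ts x y"

lemma before_append:
  "before (ss @ ts) x y \<longleftrightarrow>
     before ss x y \<or> x \<in> forest_leaves ss \<and> y \<in> forest_leaves ts \<or> before ts x y"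
  by (induction ss) auto

lemma before_leaves: "before ts x y \<Longrightarrow> x \<in> forest_leaves ts \<and> y \<in> forest_leaves ts"
  by (induction ts) auto

lemma before_not_same:
  "distinct (concat (map leaves ts)) \<Longrightarrow> t \<in> set ts \<Longrightarrow> x \<in> leaf_set t \<Longrightarrow> y \<in> leaf_set t \<Longrightarrow>
     \<not> before ts x y"
  by (induction ts) (auto simp: set_leaves dest: before_leaves)

lemma before_asym: "distinct (concat (map leaves ts)) \<Longrightarrow> before ts x y \<Longrightarrow> \<not> before ts y x"
  by (induction ts) (auto simp: set_leaves dest: before_leaves)

lemma before_trans:
  "distinct (concat (map leaves ts)) \<Longrightarrow> before ts x y \<Longrightarrow> before ts y z \<Longrightarrow> before ts x z"
  by (induction ts) (auto simp: set_leaves dest: before_leaves)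

lemma before_total:
  "x \<in> forest_leaves ts \<Longrightarrow> y \<in> forest_leaves ts \<Longrightarrow>
     before ts x y \<or> before ts y x \<or> (\<exists>t \<in> set ts. x \<in> leaf_set t \<and> y \<in> leaf_set t)"
  by (induction ts) auto

lemma block_disjoint:
  "distinct (concat (map leaves ts)) \<Longrightarrow> s \<in> set ts \<Longrightarrow> t \<in> set ts \<Longrightarrow> x \<in> leaf_set s \<Longrightarrow>
     x \<in> leaf_set t \<Longrightarrow> s = t"
  by (induction ts) (auto simp: set_leaves)

lemma before_block:
  assumes "t \<in> set ts" "x \<in> forest_leaves ts" "x \<notin> leaf_set t"
  shows "(\<forall>y \<in> leaf_set t. before ts y x) \<or> (\<forall>y \<in> leaf_set t. before ts x y)"
proof -
  obtain us vs where "ts = us @ t # vs" using split_list[OF assms(1)] by blast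
  then show ?thesis using assms(2,3) by (auto simp: before_append)
qed

section \<open>Simultaneous cutting of two trees\<close>

section \<open>Pairs of dissections\<close>

definition consistent :: "'a ptree list \<Rightarrow> 'a ptree list \<Rightarrow> bool" where
  "consistent xs ys \<longleftrightarrow> (\<forall>p q. before xs p q \<longrightarrow> \<not> before ys q p)"

text \<open>The leaf \<open>w\<close> is what forced the order \<open>p, q, r\<close>: the block of \<open>p, q\<close> (or of
  \<open>q, r\<close>) was cut while it met the block \<open>x\<close> and also, in \<open>w\<close>, another block.\<close>

definition anchored :: "'a ptree \<Rightarrow> 'a ptree list \<Rightarrow> 'a ptree list \<Rightarrow> bool" where
  "anchored t ts ss \<longleftrightarrow> (\<forall>x \<in> set ss. \<forall>p \<in> leaf_set x. \<forall>q \<in> leaf_set x. \<forall>r \<in> leaf_set x.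
     before ts p q \<longrightarrow> before ts q r \<longrightarrow>
       (\<exists>w \<in> leaf_set t - leaf_set x. caterpillar t w p q r \<or> caterpillar t w r q p))"

definition compatible ::
  "'a ptree \<Rightarrow> 'a ptree \<Rightarrow> 'a ptree list \<Rightarrow> 'a ptree list \<Rightarrow> bool" where
  "compatible L R xs ys \<longleftrightarrow> dissection L xs \<and> dissection R ys \<and> consistent xs ys \<and>
     anchored L xs ys \<and> anchored R ys xs"

lemma consistent_sym: "consistent xs ys \<Longrightarrow> consistent ys xs"
  by (auto simp: consistent_def)

lemma compatible_sym: "compatible L R xs ys \<Longrightarrow> compatible R L ys xs"
  by (auto simp: compatible_def consistent_sym)

text \<open>Start of the process: in a list of one block no two leaves are comparable, so
  consistency and anchoring hold vacuously.\<close>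

lemma compatible_whole: "compatible L R [L] [R]"
  by (auto simp: compatible_def consistent_def anchored_def intro: dissection.whole)

text \<open>The assumptions are symmetric in the two trees, by \<open>obstructed_sym\<close>, so a
  second interpretation with \<open>L\<close> and \<open>R\<close> exchanged transfers results on
  cuts in \<open>L\<close> to cuts in \<open>R\<close>.\<close>

locale unobstructed =
  fixes L R :: "'a ptree"
  assumes distinct_L: "distinct (leaves L)" and distinct_R: "distinct (leaves R)"
    and leaf_sets: "leaf_set L = leaf_set R"
    and unobstructed: "\<not> obstructed L R"
begin

text \<open>The cluster of \<open>P\<close> separates \<open>p, r\<close> from \<open>q\<close>, and
  that of \<open>x\<close> separates all three from the anchor \<open>w\<close>, so \<open>L\<close>
  induces (((p,r),q),w). The caterpillar that the anchor supplies in \<open>R\<close> completes this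
  to \<open>T1\<close>. The disjunction on \<open>x\<close> lets the lemma exclude both patterns P,
  Q, P and Q, P, Q.\<close>

lemma no_alternation:
  assumes comp: "compatible L R (us @ x # vs) ys"
    and x: "x = Node P Q \<or> x = Node Q P"
    and P: "p \<in> leaf_set P" "r \<in> leaf_set P" and Q: "q \<in> leaf_set Q"
    and pqr: "before ys p q" "before ys q r"
  shows False
proof -
  have "dissection L (us @ x # vs)" and dR: "dissection R ys"
    and anc: "anchored R ys (us @ x # vs)"
    using comp by (auto simp: compatible_def)
  then have cl: "clusters x \<subseteq> clusters L" and dx: "distinct (leaves x)"
    using dissection_clusters[of L _ x] dissection_distinct[of L "us @ x # vs"] distinct_L by auto
  have dys: "distinct (concat (map leaves ys))"
    using dissection_distinct[OF dR distinct_R] .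
  have in_x: "p \<in> leaf_set x" "q \<in> leaf_set x" "r \<in> leaf_set x" using x P Q by auto
  then obtain w where w: "w \<in> leaf_set R" "w \<notin> leaf_set x"
    "caterpillar R w p q r \<or> caterpillar R w r q p"
    using anc[unfolded anchored_def, rule_format, of x p q r] pqr by auto
  have "before ys p r" using before_trans[OF dys] pqr by blast
  then have ne: "p \<noteq> r" "p \<noteq> q" "q \<noteq> r" "w \<noteq> p" "w \<noteq> q" "w \<noteq> r"
    using pqr before_asym[OF dys] w(2) in_x by blast+
  have PL: "leaf_set P \<in> clusters L" "leaf_set x \<in> clusters L"
    using cl leaf_set_in_clusters[of P] leaf_set_in_clusters[of x] x by auto
  moreover have "q \<notin> leaf_set P" "w \<notin> leaf_set P" using dx x Q w(2) by (auto simp: set_leaves)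
  ultimately have cat: "caterpillar L p r q w" "caterpillar L r p q w"
    using P w(2) in_x by (auto intro: caterpillarI)
  have sub: "{p, q, r, w} \<subseteq> leaf_set L"
    using w(1) leaf_sets clusters_subset[OF PL(2)] in_x by auto
  from w(3) have "obstructed L R"
  proof
    assume "caterpillar R w p q r"
    then show ?thesis
      using cat sub ne caterpillar_commute[of R w p]
      by (intro obstructedI_caterpillars[of p r q w]) auto
  next
    assume "caterpillar R w r q p"
    then show ?thesis
      using cat sub ne caterpillar_commute[of R w r]
      by (intro obstructedI_caterpillars[of r p q w]) auto
  qed
  with unobstructed show False ..
qed

text \<open>If both orders of the parts fail, the witnesses and the absence of alternations force
  two blocks of \<open>ys\<close> that each contain a leaf of \<open>P\<close> and a leaf of
  \<open>Q\<close>. Against the partition into \<open>P\<close> and \<open>Q\<close> this is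
  \<open>T2\<close>.\<close>

lemma split_order_exists:
  assumes comp: "compatible L R (us @ x # vs) ys"
    and x: "x = Node P Q"
  shows "(\<forall>p \<in> leaf_set P. \<forall>q \<in> leaf_set Q. \<not> before ys q p) \<or>
    (\<forall>p \<in> leaf_set P. \<forall>q \<in> leaf_set Q. \<not> before ys p q)"
proof (rule ccontr)
  assume "\<not> ?thesis"
  then obtain p q p' q' where P: "p \<in> leaf_set P" "p' \<in> leaf_set P"
    and Q: "q \<in> leaf_set Q" "q' \<in> leaf_set Q" and qp: "before ys q p" and pq: "before ys p' q'"
    by blast
  have PQP: "\<not> (before ys a b \<and> before ys b c)"
    if "a \<in> leaf_set P" "b \<in> leaf_set Q" "c \<in> leaf_set P" for a b c
    using no_alternation[OF comp, of P Q] x that by blast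
  have QPQ: "\<not> (before ys a b \<and> before ys b c)"
    if "a \<in> leaf_set Q" "b \<in> leaf_set P" "c \<in> leaf_set Q" for a b c
    using no_alternation[OF comp, of Q P] x that by blast
  have dL: "dissection L (us @ x # vs)" and dR: "dissection R ys"
    using comp by (auto simp: compatible_def)
  have cl: "clusters x \<subseteq> clusters L" and dx: "distinct (leaves x)"
    using dissection_clusters[OF dL, of x] dissection_distinct[OF dL distinct_L] by auto
  have dys: "distinct (concat (map leaves ys))"
    using dissection_distinct[OF dR distinct_R] .
  have PL: "leaf_set P \<in> clusters L" "leaf_set Q \<in> clusters L"
    using cl leaf_set_in_clusters[of P] leaf_set_in_clusters[of Q] x by auto
  have inS: "{p, p', q', q} \<subseteq> leaf_set L"
    using P Q PL[THEN clusters_subset] by auto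
  then have inY: "{p, p', q', q} \<subseteq> forest_leaves ys"
    using leaf_sets dissection_leaves[OF dR] by simp
  \<comment> \<open>Each of these comparisons would extend \<open>before ys q p\<close> or
    \<open>before ys p' q'\<close> to an alternating chain of three leaves.\<close>
  have "\<not> before ys p q'" "\<not> before ys q' p" "\<not> before ys q p'" "\<not> before ys p' q"
    using PQP QPQ P Q qp pq by blast+
  then obtain y1 y2 where y1: "y1 \<in> set ys" "p \<in> leaf_set y1" "q' \<in> leaf_set y1"
    and y2: "y2 \<in> set ys" "p' \<in> leaf_set y2" "q \<in> leaf_set y2"
    using inY before_total[of p ys q'] before_total[of q ys p'] by auto
  have "y1 \<noteq> y2" using before_not_same[OF dys] y1 y2 qp by blast
  then have y12: "p' \<notin> leaf_set y1" "q \<notin> leaf_set y1" "p \<notin> leaf_set y2" "q' \<notin> leaf_set y2"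
    using block_disjoint[OF dys y1(1) y2(1)] y1 y2 by blast+
  have PQ: "leaf_set P \<inter> leaf_set Q = {}" using dx x by (auto simp: set_leaves)
  have "balanced L p p' q' q"
    using PL P Q PQ by (intro balancedI[of "leaf_set P" L "leaf_set Q"]) auto
  moreover have "leaf_set y1 \<in> clusters R" "leaf_set y2 \<in> clusters R"
    using dissection_clusters[OF dR] y1(1) y2(1) leaf_set_in_clusters by blast+
  then have "balanced R p q' p' q"
    using y1 y2 y12 by (intro balancedI[of "leaf_set y1" R "leaf_set y2"]) auto
  moreover have "distinct [p, p', q', q]"
    using P Q PQ y1 y2 y12 by auto
  ultimately have "obstructed L R" using inS by (intro obstructedI_balanced)
  with unobstructed show False ..
qed

text \<open>Consistency survives by \<open>ord\<close>, and the anchors in \<open>R\<close> survive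
  because the blocks on the left only shrink. The new comparisons, from \<open>P\<close> to
  \<open>Q\<close>, can create new chains inside a block \<open>y\<close>; \<open>pending\<close>
  then yields a leaf \<open>s\<close> of \<open>x\<close> outside \<open>y\<close>, and
  \<open>s\<close> is the anchor in \<open>L\<close>.\<close>

lemma compatible_split_ordered:
  assumes comp: "compatible L R (us @ x # vs) ys"
    and x: "x = Node P Q \<or> x = Node Q P"
    and pending: "us = [] \<and> vs = [] \<or> (\<forall>y \<in> set ys. \<not> leaf_set x \<subseteq> leaf_set y)"
    and ord: "\<And>p q. p \<in> leaf_set P \<Longrightarrow> q \<in> leaf_set Q \<Longrightarrow> \<not> before ys q p"
  shows "compatible L R (us @ P # Q # vs) ys"
proof -
  let ?xs = "us @ x # vs" and ?xs' = "us @ P # Q # vs"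
  have dL: "dissection L ?xs" and dR: "dissection R ys" and con: "consistent ?xs ys"
    and ancL: "anchored L ?xs ys" and ancR: "anchored R ys ?xs"
    using comp by (auto simp: compatible_def)
  have dL': "dissection L ?xs'"
    using dL x by (auto intro: dissection.intros)
  have dxs: "distinct (concat (map leaves ?xs))"
    using dissection_distinct[OF dL distinct_L] .
  have dys: "distinct (concat (map leaves ys))"
    using dissection_distinct[OF dR distinct_R] .
  have lx: "leaf_set x = leaf_set P \<union> leaf_set Q" using x by auto
  have PQ: "leaf_set P \<inter> leaf_set Q = {}" using dxs x by (auto simp: set_leaves)
  have "clusters x \<subseteq> clusters L" using dissection_clusters[OF dL, of x] by auto
  then have cl: "leaf_set x \<in> clusters L" "leaf_set P \<in> clusters L" "leaf_set Q \<in> clusters L"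
    using leaf_set_in_clusters[of P] leaf_set_in_clusters[of Q] leaf_set_in_clusters[of x] x by auto
  have forest: "forest_leaves ?xs = leaf_set L" "forest_leaves ys = leaf_set L"
    using dissection_leaves[OF dL] dissection_leaves[OF dR] leaf_sets by auto
  have bef: "before ?xs' a b \<longleftrightarrow> before ?xs a b \<or> a \<in> leaf_set P \<and> b \<in> leaf_set Q" for a b
    by (auto simp: before_append lx)
  have con': "consistent ?xs' ys"
    using con ord unfolding consistent_def bef by blast
  have "anchored R ys ?xs'"
    unfolding anchored_def
  proof (intro ballI impI)
    fix z p q r
    assume z: "z \<in> set ?xs'" "p \<in> leaf_set z" "q \<in> leaf_set z" "r \<in> leaf_set z"
      and pqr: "before ys p q" "before ys q r"
    obtain z' where z': "z' \<in> set ?xs" "leaf_set z \<subseteq> leaf_set z'"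
      using z(1) lx by auto
    then show "\<exists>w \<in> leaf_set R - leaf_set z. caterpillar R w p q r \<or> caterpillar R w r q p"
      using ancR[unfolded anchored_def, rule_format, of z' p q r] z(2-4) pqr by blast
  qed
  moreover have "anchored L ?xs' ys"
    unfolding anchored_def
  proof (intro ballI impI)
    fix y p q r
    assume y: "y \<in> set ys" "p \<in> leaf_set y" "q \<in> leaf_set y" "r \<in> leaf_set y"
      and pqr: "before ?xs' p q" "before ?xs' q r"
    \<comment> \<open>A chain uses the new comparison at most once, since \<open>P\<close> and
      \<open>Q\<close> are disjoint.\<close>
    consider "before ?xs p q" "before ?xs q r" | "p \<in> leaf_set P" "q \<in> leaf_set Q" "before ?xs q r"
      | "before ?xs p q" "q \<in> leaf_set P" "r \<in> leaf_set Q"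
      using pqr PQ unfolding bef by blast
    then show "\<exists>w \<in> leaf_set L - leaf_set y. caterpillar L w p q r \<or> caterpillar L w r q p"
    proof cases
      case 1
      then show ?thesis
        using ancL[unfolded anchored_def, rule_format, of y p q r] y by blast
    next
      case 2
      \<comment> \<open>The leaf \<open>r\<close> comes after \<open>q\<close> in the old list,
        hence outside the block \<open>x\<close>; so \<open>x\<close> is not alone and the second
        alternative of \<open>pending\<close> applies.\<close>
      have "us \<noteq> [] \<or> vs \<noteq> []" using 2 by auto
      then obtain s where s: "s \<in> leaf_set x" "s \<notin> leaf_set y"
        using pending y(1) by blast
      have sL: "s \<in> leaf_set L" using s(1) clusters_subset[OF cl(1)] by blast
      have rx: "r \<in> forest_leaves ?xs" "r \<notin> leaf_set x"
        using before_leaves[of ?xs q r] before_not_same[OF dxs, of x q r] 2 lx by auto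
      have bx: "before ?xs a r" if "a \<in> leaf_set x" for a
      proof -
        have "\<not> before ?xs r q" "q \<in> leaf_set x"
          using 2 lx before_asym[OF dxs] by auto
        then show ?thesis using before_block[of x ?xs r] rx that by auto
      qed
      \<comment> \<open>The whole block \<open>x\<close> precedes \<open>r\<close>, so by
        consistency \<open>s\<close> does not follow \<open>r\<close>; being outside
        \<open>y\<close>, it precedes all of \<open>y\<close>. In particular it precedes
        \<open>p\<close>, and \<open>ord\<close> then excludes \<open>s\<close> from
        \<open>Q\<close>.\<close>
      then have "\<not> before ys r s" using con bx[OF s(1)] unfolding consistent_def by blast
      then have sy: "before ys s a" if "a \<in> leaf_set y" for a
        using before_block[OF y(1), of s] s(2) sL forest(2) y that by auto
      have "s \<in> leaf_set P"
        using s(1) sy[OF y(2)] 2(1) ord lx by blast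
      then have "caterpillar L s p q r"
        using 2 lx PQ rx(2) cl by (intro caterpillarI[of "leaf_set P" L "leaf_set x"]) auto
      then show ?thesis using sL s(2) by blast
    next
      case 3
      \<comment> \<open>Mirror image of the previous case: now \<open>s\<close> follows all of
        \<open>y\<close> and therefore lies in \<open>Q\<close>.\<close>
      have "us \<noteq> [] \<or> vs \<noteq> []" using 3 by auto
      then obtain s where s: "s \<in> leaf_set x" "s \<notin> leaf_set y"
        using pending y(1) by blast
      have sL: "s \<in> leaf_set L" using s(1) clusters_subset[OF cl(1)] by blast
      have px: "p \<in> forest_leaves ?xs" "p \<notin> leaf_set x"
        using before_leaves[of ?xs p q] before_not_same[OF dxs, of x p q] 3 lx by auto
      have bx: "before ?xs p a" if "a \<in> leaf_set x" for a
      proof -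
        have "\<not> before ?xs q p" "q \<in> leaf_set x"
          using 3 lx before_asym[OF dxs] by auto
        then show ?thesis using before_block[of x ?xs p] px that by auto
      qed
      then have "\<not> before ys s p" using con bx[OF s(1)] unfolding consistent_def by blast
      then have ys: "before ys a s" if "a \<in> leaf_set y" for a
        using before_block[OF y(1), of s] s(2) sL forest(2) y that by auto
      have "s \<in> leaf_set Q"
        using s(1) ys[OF y(4)] 3(3) ord lx by blast
      then have "caterpillar L s r q p"
        using 3 lx PQ px(2) cl by (intro caterpillarI[of "leaf_set Q" L "leaf_set x"]) auto
      then show ?thesis using sL s(2) by blast
    qed
  qed
  ultimately show ?thesis
    using dL' dR con' unfolding compatible_def by blast
qed

lemma compatible_split:
  assumes comp: "compatible L R (us @ Node P Q # vs) ys"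
    and pending: "us = [] \<and> vs = [] \<or> (\<forall>y \<in> set ys. \<not> leaf_set (Node P Q) \<subseteq> leaf_set y)"
  shows "compatible L R (us @ P # Q # vs) ys \<or> compatible L R (us @ Q # P # vs) ys"
  using split_order_exists[OF comp refl] compatible_split_ordered[OF comp _ pending, of P Q]
    compatible_split_ordered[OF comp _ pending, of Q P] by blast

end

section \<open>Termination of the cutting process and induction on size\<close>

section \<open>Common leaf orders\<close>

text \<open>No cut of \<open>xs\<close> is due: at every inner vertex that heads a block, the
  condition \<open>pending\<close> of \<open>compatible_split\<close> fails.\<close>

definition settled :: "'a ptree list \<Rightarrow> 'a ptree list \<Rightarrow> bool" where
  "settled xs ys \<longleftrightarrow> (\<forall>us P Q vs. xs = us @ Node P Q # vs \<longrightarrow>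
     \<not> (us = [] \<and> vs = []) \<and> (\<exists>y \<in> set ys. leaf_set (Node P Q) \<subseteq> leaf_set y))"

lemma (in unobstructed) split_unsettled:
  assumes "compatible L R xs ys" "\<not> settled xs ys"
  shows "\<exists>xs'. compatible L R xs' ys \<and> length xs < length xs'"
proof -
  obtain us P Q vs where xs: "xs = us @ Node P Q # vs"
    and "us = [] \<and> vs = [] \<or> (\<forall>y \<in> set ys. \<not> leaf_set (Node P Q) \<subseteq> leaf_set y)"
    using assms(2) unfolding settled_def by blast
  then have "compatible L R (us @ P # Q # vs) ys \<or> compatible L R (us @ Q # P # vs) ys"
    using assms(1) by (intro compatible_split) simp_all
  then show ?thesis unfolding xs by (elim disjE) (rule exI, erule conjI, simp)+
qed

text \<open>A compatible pair with the largest total number of blocks admits no further cut on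
  either side.\<close>

lemma (in unobstructed) settled_exists:
  "\<exists>xs ys. compatible L R xs ys \<and> settled xs ys \<and> settled ys xs"
proof -
  interpret sym: unobstructed R L
    using distinct_L distinct_R leaf_sets unobstructed obstructed_sym[of R L]
    by unfold_locales auto
  let ?C = "\<lambda>p. compatible L R (fst p) (snd p)" and ?len = "\<lambda>p. length (fst p) + length (snd p)"
  have "?C ([L], [R])" by (simp add: compatible_whole)
  \<comment> \<open>The \<open>Suc\<close> provides the strict upper bound required for the
    existence of a maximum.\<close>
  moreover have "\<forall>p. ?C p \<longrightarrow> ?len p < Suc (length (leaves L) + length (leaves R))"
    by (auto simp: compatible_def less_Suc_eq_le intro!: add_mono dest: dissection_length)
  ultimately have "\<exists>p. ?C p \<and> (\<forall>q. ?C q \<longrightarrow> ?len q \<le> ?len p)"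
    by (rule Lattices_Big.ex_has_greatest_nat[where P = ?C and f = ?len])
  then obtain xs ys where comp: "compatible L R xs ys"
    and max: "\<And>xs' ys'. compatible L R xs' ys' \<Longrightarrow>
      length xs' + length ys' \<le> length xs + length ys"
    by auto
  have "settled xs ys"
  proof (rule ccontr)
    assume "\<not> settled xs ys"
    then obtain xs' where "compatible L R xs' ys" "length xs < length xs'"
      using split_unsettled[OF comp] by blast
    then show False using max[of xs' ys] by simp
  qed
  moreover have "settled ys xs"
  proof (rule ccontr)
    assume "\<not> settled ys xs"
    then obtain ys' where "compatible R L ys' xs" "length ys < length ys'"
      using sym.split_unsettled[OF compatible_sym[OF comp]] by blast
    then show False using max[of xs ys'] compatible_sym by fastforce
  qed
  ultimately show ?thesis using comp by blast
qed

text \<open>If the first blocks differed, each would have its counterpart later in the other list,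
  and the two lists would order their leaves in opposite ways.\<close>

lemma consistent_blocks_align:
  assumes "distinct (concat (map leaves xs))" "distinct (concat (map leaves ys))"
    and "consistent xs ys"
    and "\<forall>x \<in> set xs. \<exists>y \<in> set ys. leaf_set x = leaf_set y"
    and "\<forall>y \<in> set ys. \<exists>x \<in> set xs. leaf_set x = leaf_set y"
  shows "list_all2 (\<lambda>x y. leaf_set x = leaf_set y) xs ys"
  using assms
proof (induction xs arbitrary: ys)
  case Nil
  then show ?case by simp
next
  case (Cons x xs)
  obtain y ys' where ys: "ys = y # ys'" using Cons.prems(4) by (cases ys) auto
  obtain a where a: "a \<in> leaf_set x" using leaf_set_nonempty[of x] by blast
  obtain b where b: "b \<in> leaf_set y" using leaf_set_nonempty[of y] by blast
  have x_xs: "\<forall>x' \<in> set xs. leaf_set x \<inter> leaf_set x' = {}"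
    using Cons.prems(1) by (auto simp: set_leaves)
  have y_ys: "\<forall>y' \<in> set ys'. leaf_set y \<inter> leaf_set y' = {}"
    using Cons.prems(2) ys by (auto simp: set_leaves)
  have xy: "leaf_set x = leaf_set y"
  proof (rule ccontr)
    assume ne: "leaf_set x \<noteq> leaf_set y"
    then obtain x' y' where "y' \<in> set ys'" "leaf_set x = leaf_set y'"
      "x' \<in> set xs" "leaf_set x' = leaf_set y"
      using Cons.prems(4,5) ys by auto
    then have "before (x # xs) a b" "before ys b a" using a b ys by auto
    then show False using Cons.prems(3) unfolding consistent_def by blast
  qed
  have "consistent xs ys'"
    unfolding consistent_def
  proof (intro allI impI notI)
    fix p q assume "before xs p q" "before ys' q p"
    then have "before (x # xs) p q" "before ys q p" using ys by simp_all
    then show False using Cons.prems(3) unfolding consistent_def by blast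
  qed
  moreover have "\<forall>x' \<in> set xs. \<exists>y' \<in> set ys'. leaf_set x' = leaf_set y'"
  proof
    fix x' assume x': "x' \<in> set xs"
    then obtain y' where y': "y' \<in> set ys" "leaf_set x' = leaf_set y'"
      using Cons.prems(4) by auto
    then have "y' \<noteq> y" using x_xs x' xy a by blast
    then show "\<exists>y' \<in> set ys'. leaf_set x' = leaf_set y'" using y' ys by auto
  qed
  moreover have "\<forall>y' \<in> set ys'. \<exists>x' \<in> set xs. leaf_set x' = leaf_set y'"
  proof
    fix y' assume y': "y' \<in> set ys'"
    then obtain x' where x': "x' \<in> set (x # xs)" "leaf_set x' = leaf_set y'"
      using Cons.prems(5) ys by (meson list.set_intros(2))
    then have "x' \<noteq> x" using y_ys y' xy b by blast
    then show "\<exists>x' \<in> set xs. leaf_set x' = leaf_set y'" using x' by auto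
  qed
  ultimately show ?case using Cons.IH[of ys'] Cons.prems(1,2) ys xy by simp
qed

text \<open>The definition of \<open>settled\<close> only concerns blocks with an inner vertex; a
  single leaf is covered trivially.\<close>

lemma settled_covered:
  assumes "settled xs ys" "x \<in> set xs" "leaf_set x \<subseteq> forest_leaves ys"
  shows "\<exists>y \<in> set ys. leaf_set x \<subseteq> leaf_set y"
proof (cases x)
  case (Leaf a)
  then show ?thesis using assms(3) by auto
next
  case (Node P Q)
  then show ?thesis
    using assms(1,2) split_list[of x xs] unfolding settled_def by blast
qed

lemma matching_switches_exist:
  assumes "list_all2 (\<lambda>x y. \<exists>x' y'. switch_tree\<^sup>*\<^sup>* x x' \<and> switch_tree\<^sup>*\<^sup>* y y' \<and>
    leaves x' = leaves y') xs ys"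
  shows "\<exists>xs' ys'. list_all2 switch_tree\<^sup>*\<^sup>* xs xs' \<and> list_all2 switch_tree\<^sup>*\<^sup>* ys ys' \<and>
    map leaves xs' = map leaves ys'"
  using assms
proof (induction rule: list_all2_induct)
  case Nil
  show ?case by (intro exI[of _ "[]"]) simp
next
  case (Cons x xs y ys)
  then obtain x' y' xs' ys' where "switch_tree\<^sup>*\<^sup>* x x'" "switch_tree\<^sup>*\<^sup>* y y'" "leaves x' = leaves y'"
    "list_all2 switch_tree\<^sup>*\<^sup>* xs xs'" "list_all2 switch_tree\<^sup>*\<^sup>* ys ys'" "map leaves xs' = map leaves ys'"
    by blast
  then show ?case by (intro exI[of _ "x' # xs'"] exI[of _ "y' # ys'"]) simp
qed

text \<open>The core of the proof. In a settled pair the blocks match in leaf sets and in order; the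
  induction hypothesis aligns the leaves within each matched pair, and reassembly gives the whole
  trees.\<close>

lemma common_leaf_order:
  assumes "distinct (leaves L)" "distinct (leaves R)" "leaf_set L = leaf_set R" "\<not> obstructed L R"
  shows "\<exists>L' R'. switch_tree\<^sup>*\<^sup>* L L' \<and> switch_tree\<^sup>*\<^sup>* R R' \<and> leaves L' = leaves R'"
  using assms
proof (induction "card (leaf_set L)" arbitrary: L R rule: less_induct)
  case less
  interpret unobstructed L R using less.prems by unfold_locales
  obtain xs ys where "compatible L R xs ys" and settled: "settled xs ys" "settled ys xs"
    using settled_exists by blast
  then have dL: "dissection L xs" and dR: "dissection R ys" and con: "consistent xs ys"
    by (auto simp: compatible_def)
  have dxs: "distinct (concat (map leaves xs))" and dys: "distinct (concat (map leaves ys))"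
    using dissection_distinct dL dR less.prems(1,2) by blast+
  have forest: "forest_leaves xs = forest_leaves ys"
    using dissection_leaves[OF dL] dissection_leaves[OF dR] less.prems(3) by simp
  have xy: "\<exists>y \<in> set ys. leaf_set x \<subseteq> leaf_set y" if "x \<in> set xs" for x
    using settled_covered[OF settled(1) that] that forest by blast
  have yx: "\<exists>x \<in> set xs. leaf_set y \<subseteq> leaf_set x" if "y \<in> set ys" for y
    using settled_covered[OF settled(2) that] that forest by blast
  have "\<exists>y \<in> set ys. leaf_set x = leaf_set y" if x: "x \<in> set xs" for x
  proof -
    obtain y x' where y: "y \<in> set ys" "leaf_set x \<subseteq> leaf_set y"
      and x': "x' \<in> set xs" "leaf_set y \<subseteq> leaf_set x'"
      using xy[OF x] yx by blast
    \<comment> \<open>The sandwich of \<open>x\<close>, \<open>y\<close> and \<open>x'\<close>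
      collapses, since distinct blocks of one list are disjoint.\<close>
    then have "x = x'" using block_disjoint[OF dxs x x'(1)] leaf_set_nonempty[of x] by blast
    then show ?thesis using y x' by blast
  qed
  moreover have "\<exists>x \<in> set xs. leaf_set x = leaf_set y" if y: "y \<in> set ys" for y
  proof -
    obtain x y' where x: "x \<in> set xs" "leaf_set y \<subseteq> leaf_set x"
      and y': "y' \<in> set ys" "leaf_set x \<subseteq> leaf_set y'"
      using yx[OF y] xy by blast
    then have "y = y'" using block_disjoint[OF dys y y'(1)] leaf_set_nonempty[of y] by blast
    then show ?thesis using x y' by blast
  qed
  ultimately have "list_all2 (\<lambda>x y. leaf_set x = leaf_set y) xs ys"
    using consistent_blocks_align[OF dxs dys con] by blast
  then have "list_all2 (\<lambda>x y. \<exists>x' y'. switch_tree\<^sup>*\<^sup>* x x' \<and> switch_tree\<^sup>*\<^sup>* y y' \<and>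
    leaves x' = leaves y') xs ys"
  proof (rule list.rel_mono_strong)
    fix x y assume x: "x \<in> set xs" and y: "y \<in> set ys" and eq: "leaf_set x = leaf_set y"
    have dx: "distinct (leaves x)" and dy: "distinct (leaves y)"
      using x y dxs dys by (auto simp: distinct_concat_iff)
    show "\<exists>x' y'. switch_tree\<^sup>*\<^sup>* x x' \<and> switch_tree\<^sup>*\<^sup>* y y' \<and> leaves x' = leaves y'"
    proof (cases x)
      case (Leaf a)
      then have "y = Leaf a" using leaf_set_singleton_imp_Leaf[OF dy] eq by simp
      then show ?thesis using Leaf by blast
    next
      case (Node P Q)
      obtain us vs where xs: "xs = us @ x # vs" using split_list[OF x] by blast
      \<comment> \<open>Settledness excludes a tree that is still whole, so another block exists and
        \<open>x\<close> has strictly fewer leaves than \<open>L\<close>.\<close>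
      then have "us @ vs \<noteq> []" using settled(1) Node unfolding settled_def by simp
      then obtain z where "z \<in> set (us @ vs)" by (cases "us @ vs") auto
      then have "leaf_set x \<inter> leaf_set z = {}" "leaf_set z \<subseteq> leaf_set L"
        using dxs dissection_leaves[OF dL] by (auto simp: xs set_leaves)
      moreover have "leaf_set x \<subseteq> leaf_set L" using dissection_leaves[OF dL] x by blast
      ultimately have "card (leaf_set x) < card (leaf_set L)"
        using leaf_set_nonempty[of z] by (intro psubset_card_mono finite_leaf_set) blast
      moreover have "\<not> obstructed x y"
        using obstructed_mono dissection_clusters[OF dL x] dissection_clusters[OF dR y]
          less.prems(4) by blast
      ultimately show ?thesis using less.hyps[OF _ dx dy eq] by blast
    qed
  qed
  then obtain xs' ys' where "list_all2 switch_tree\<^sup>*\<^sup>* xs xs'" "list_all2 switch_tree\<^sup>*\<^sup>* ys ys'"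
    "map leaves xs' = map leaves ys'"
    using matching_switches_exist by blast
  then show ?case
    using dissection_switches[OF dL, of xs'] dissection_switches[OF dR, of ys'] by metis
qed

section \<open>Normal form of layouts\<close>

section \<open>Layouts and tanglegrams\<close>

lemma switches_Layout:
  assumes "switch_tree\<^sup>*\<^sup>* L L'" "switch_tree\<^sup>*\<^sup>* R R'"
  shows "switch\<^sup>*\<^sup>* (Layout L R M) (Layout L' R' M)"
proof -
  have "switch\<^sup>*\<^sup>* (Layout L R M) (Layout L' R M)"
    using assms(1)
    by (induction rule: rtranclp_induct) (blast intro: rtranclp.rtrancl_into_rtrancl switch.left)+
  moreover have "switch\<^sup>*\<^sup>* (Layout L' R M) (Layout L' R' M)"
    using assms(2)
    by (induction rule: rtranclp_induct) (blast intro: rtranclp.rtrancl_into_rtrancl switch.right)+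
  ultimately show ?thesis by simp
qed

lemma switches_LayoutE:
  assumes "switch\<^sup>*\<^sup>* (Layout L R M) Z"
  obtains L' R' where "Z = Layout L' R' M" "switch_tree\<^sup>*\<^sup>* L L'" "switch_tree\<^sup>*\<^sup>* R R'"
proof -
  from assms have "\<exists>L' R'. Z = Layout L' R' M \<and> switch_tree\<^sup>*\<^sup>* L L' \<and> switch_tree\<^sup>*\<^sup>* R R'"
  proof (induction rule: rtranclp_induct)
    case base
    show ?case by blast
  next
    case (step Y Z)
    then obtain L' R' where Y: "Y = Layout L' R' M" "switch_tree\<^sup>*\<^sup>* L L'" "switch_tree\<^sup>*\<^sup>* R R'"
      by blast
    from step(2) show ?case
      unfolding Y(1)
    proof cases
      case (left L'')
      then show ?thesis using Y(2,3) rtranclp.rtrancl_into_rtrancl by fast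
    next
      case (right R'')
      then show ?thesis using Y(2,3) rtranclp.rtrancl_into_rtrancl by fast
    qed
  qed
  then show ?thesis using that by blast
qed

lemma layout_equiv_switches:
  assumes "switch\<^sup>*\<^sup>* X Y" "is_layout X"
  shows "layout_equiv X Y"
proof -
  have "is_layout Y" using assms by (rule switches_is_layout)
  then show ?thesis
    using assms unfolding layout_equiv_def
    by (intro conjI exI[of _ Y] exI[of _ id]) (simp_all add: rename_id)
qed

lemma layout_equiv_rename:
  assumes "is_layout X" "is_layout (rename f g X)"
    and "inj_on f (leaf_set (left_tree X))" "inj_on g (leaf_set (right_tree X))"
  shows "layout_equiv X (rename f g X)"
  using assms unfolding layout_equiv_def by blast

text \<open>The normal form behind \<open>tanglegram_of\<close>: names encode the matching, so only
  the pair of trees remains to be studied.\<close>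

definition diagonal :: "nat ptree \<Rightarrow> nat ptree \<Rightarrow> layout" where
  "diagonal L R = Layout L R (Id_on (leaf_set L))"

lemma left_diagonal: "left_tree (diagonal L R) = L"
  and right_diagonal: "right_tree (diagonal L R) = R"
  and matching_diagonal: "matching (diagonal L R) = Id_on (leaf_set L)"
  by (simp_all add: diagonal_def)

text \<open>Every leaf on the right is renamed to its partner on the left, which is the map
  \<open>h\<close>; the left tree stays as it is.\<close>

lemma layout_equiv_diagonal:
  assumes "is_layout X"
  obtains R where "distinct (leaves R)" "leaf_set (left_tree X) = leaf_set R"
    "layout_equiv X (diagonal (left_tree X) R)"
proof (cases X)
  case (Layout L S M)
  have dist: "distinct (leaves L)" "distinct (leaves S)"
    and M: "M \<subseteq> leaf_set L \<times> leaf_set S"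
    and ex_L: "\<And>x. x \<in> leaf_set L \<Longrightarrow> \<exists>!y. (x, y) \<in> M"
    and ex_S: "\<And>y. y \<in> leaf_set S \<Longrightarrow> \<exists>!x. (x, y) \<in> M"
    using assms Layout by (auto simp: is_layout_def)
  define h where "h y = (THE x. (x, y) \<in> M)" for y
  have h: "h y = x" if "(x, y) \<in> M" for x y
    unfolding h_def using that ex_S M by (intro the1_equality) auto
  have hM: "(h y, y) \<in> M" if "y \<in> leaf_set S" for y
    using ex_S[OF that] h by blast
  have inj: "inj_on h (leaf_set S)"
  proof (rule inj_onI)
    fix y z assume "y \<in> leaf_set S" "z \<in> leaf_set S" "h y = h z"
    then show "y = z" using hM[of y] hM[of z] ex_L[of "h y"] M by auto
  qed
  have "h ` leaf_set S = leaf_set L"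
  proof
    show "h ` leaf_set S \<subseteq> leaf_set L" using hM M by blast
    show "leaf_set L \<subseteq> h ` leaf_set S"
    proof
      fix x assume "x \<in> leaf_set L"
      then obtain y where "(x, y) \<in> M" using ex_L by blast
      then show "x \<in> h ` leaf_set S" using h[of x y] M by blast
    qed
  qed
  then have R: "leaf_set (map_ptree h S) = leaf_set L" by (simp add: ptree.set_map)
  have dR: "distinct (leaves (map_ptree h S))"
    using dist inj by (simp add: leaves_map distinct_map set_leaves)
  have "map_prod id h ` M = Id_on (leaf_set L)"
  proof
    show "map_prod id h ` M \<subseteq> Id_on (leaf_set L)" using h M by fastforce
    show "Id_on (leaf_set L) \<subseteq> map_prod id h ` M"
    proof
      fix e assume "e \<in> Id_on (leaf_set L)"
      then obtain x where x: "e = (x, x)" "x \<in> leaf_set L" by blast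
      then obtain y where "(x, y) \<in> M" using ex_L by blast
      then show "e \<in> map_prod id h ` M" using h[of x y] x by force
    qed
  qed
  then have ren: "rename id h X = diagonal L (map_ptree h S)"
    using Layout by (simp add: diagonal_def ptree.map_id)
  moreover have "is_layout (diagonal L (map_ptree h S))"
    unfolding diagonal_def using dist(1) dR R by (intro tanglegram_of_is_layout) auto
  ultimately have "layout_equiv X (diagonal L (map_ptree h S))"
    using layout_equiv_rename[OF assms, of id h] inj Layout by simp
  then show ?thesis using that[of "map_ptree h S"] dR R Layout by simp
qed

lemma layout_of_exists: obtains X where "layout_of X T"
proof -
  have "layout_equiv (rep_tanglegram T) (rep_tanglegram T)"
    "abs_tanglegram (rep_tanglegram T) = T"
    using Quotient_rep_reflp[OF Quotient_tanglegram] Quotient_abs_rep[OF Quotient_tanglegram]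
    by simp_all
  then show ?thesis using that unfolding layout_of_def layout_equiv_def by blast
qed

section \<open>Order of the leaves on a vertical line\<close>

lemma above_Node:
  "above (Node u d) x y \<longleftrightarrow>
     above u x y \<or> above d x y \<or> x \<in> leaf_set u \<and> y \<in> leaf_set d"
proof
  let ?n = "length (leaves u)"
  assume "above (Node u d) x y"
  then obtain i j where ij: "i < j" "j < ?n + length (leaves d)"
    "(leaves u @ leaves d) ! i = x" "(leaves u @ leaves d) ! j = y"
    by (auto simp: above_def)
  consider "j < ?n" | "i < ?n" "?n \<le> j" | "?n \<le> i" by linarith
  then show "above u x y \<or> above d x y \<or> x \<in> leaf_set u \<and> y \<in> leaf_set d"
  proof cases
    case 1
    then have "above u x y" using ij unfolding above_def by (auto simp: nth_append)
    then show ?thesis ..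
  next
    case 2
    then have "x \<in> set (leaves u)" "y \<in> set (leaves d)"
      using ij by (auto simp: nth_append)
    then show ?thesis by (simp add: set_leaves)
  next
    case 3
    then have "above d x y"
      using ij unfolding above_def
      by (intro exI[of _ "i - ?n"] exI[of _ "j - ?n"]) (auto simp: nth_append)
    then show ?thesis by blast
  qed
next
  let ?n = "length (leaves u)"
  assume "above u x y \<or> above d x y \<or> x \<in> leaf_set u \<and> y \<in> leaf_set d"
  then consider "above u x y" | "above d x y" | "x \<in> set (leaves u)" "y \<in> set (leaves d)"
    by (auto simp: set_leaves)
  then show "above (Node u d) x y"
  proof cases
    case 1
    then obtain i j where "i < j" "j < ?n" "leaves u ! i = x" "leaves u ! j = y"
      by (auto simp: above_def)
    then show ?thesis
      unfolding above_def by (intro exI[of _ i] exI[of _ j]) (auto simp: nth_append)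
  next
    case 2
    then obtain i j where "i < j" "j < length (leaves d)" "leaves d ! i = x" "leaves d ! j = y"
      by (auto simp: above_def)
    then show ?thesis
      unfolding above_def
      by (intro exI[of _ "?n + i"] exI[of _ "?n + j"]) (auto simp: nth_append)
  next
    case 3
    then obtain i j where "i < ?n" "j < length (leaves d)" "leaves u ! i = x" "leaves d ! j = y"
      by (auto simp: in_set_conv_nth)
    then show ?thesis
      unfolding above_def
      by (intro exI[of _ i] exI[of _ "?n + j"]) (auto simp: nth_append)
  qed
qed

lemma not_above_Leaf: "\<not> above (Leaf z) x y"
  by (auto simp: above_def)

lemma above_leaves: "above t x y \<Longrightarrow> x \<in> leaf_set t \<and> y \<in> leaf_set t"
  by (induction t) (auto simp: above_Node not_above_Leaf)

lemma above_total: "x \<in> leaf_set t \<Longrightarrow> y \<in> leaf_set t \<Longrightarrow> x \<noteq> y \<Longrightarrow> above t x y \<or> above t y x"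
  by (induction t) (auto simp: above_Node not_above_Leaf)

lemma above_asym: "distinct (leaves t) \<Longrightarrow> above t x y \<Longrightarrow> \<not> above t y x"
  by (auto simp: above_def nth_eq_iff_index_eq)

lemma above_map: "above t x y \<Longrightarrow> above (map_ptree f t) (f x) (f y)"
  unfolding above_def by (force simp: leaves_map)

text \<open>A subtree occupies consecutive positions: if \<open>x\<close> and \<open>z\<close> lie
  below one child, the disjoint leaf sets of the children keep everything between them below that
  child.\<close>

lemma clusters_interval:
  "distinct (leaves t) \<Longrightarrow> C \<in> clusters t \<Longrightarrow> x \<in> C \<Longrightarrow> z \<in> C \<Longrightarrow> above t x y \<Longrightarrow> above t y z \<Longrightarrow>
     y \<in> C"
proof (induction t)
  case (Leaf a)
  then show ?case by (simp add: not_above_Leaf)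
next
  case (Node u d)
  have disj: "leaf_set u \<inter> leaf_set d = {}" using Node.prems(1) by (simp add: set_leaves)
  consider "C = leaf_set (Node u d)" | "C \<in> clusters u" | "C \<in> clusters d"
    using Node.prems(2) by auto
  then show ?case
  proof cases
    case 1
    then show ?thesis using above_leaves[OF Node.prems(5)] by simp
  next
    case 2
    then have "x \<in> leaf_set u" "z \<in> leaf_set u" using Node.prems(3,4) clusters_subset by blast+
    then have "above u x y" "above u y z"
      using Node.prems(5,6) disj above_leaves[of u] above_leaves[of d] unfolding above_Node by blast+
    then show ?thesis using Node.IH(1) Node.prems(1,3,4) 2 by simp
  next
    case 3
    then have "x \<in> leaf_set d" "z \<in> leaf_set d" using Node.prems(3,4) clusters_subset by blast+
    then have "above d x y" "above d y z"
      using Node.prems(5,6) disj above_leaves[of u] above_leaves[of d] unfolding above_Node by blast+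
    then show ?thesis using Node.IH(2) Node.prems(1,3,4) 3 by simp
  qed
qed

text \<open>The interval property of the two witnessing clusters, put as forbidden betweenness
  patterns for propositional reasoning.\<close>

lemma caterpillar_betweenness:
  assumes "distinct (leaves t)" "distinct [a, b, c, d]" "caterpillar t a b c d"
  shows "\<not> (above t a c \<and> above t c b)" "\<not> (above t b c \<and> above t c a)"
    "x \<in> {a, b, c} \<Longrightarrow> y \<in> {a, b, c} \<Longrightarrow> \<not> (above t x d \<and> above t d y)"
proof -
  obtain C D where C: "C \<in> clusters t" "{a, b} \<subseteq> C" "{c, d} \<inter> C = {}"
    and D: "D \<in> clusters t" "{a, b, c} \<subseteq> D" "d \<notin> D"
    using assms(2,3) by (auto elim: caterpillarE)
  show "\<not> (above t a c \<and> above t c b)" "\<not> (above t b c \<and> above t c a)"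
    using clusters_interval[OF assms(1) C(1)] C(2,3) by blast+
  show "x \<in> {a, b, c} \<Longrightarrow> y \<in> {a, b, c} \<Longrightarrow> \<not> (above t x d \<and> above t d y)"
    using clusters_interval[OF assms(1) D(1), of x y d] D(2,3) by blast
qed

lemma balanced_betweenness:
  assumes "distinct (leaves t)" "distinct [a, b, c, d]" "balanced t a b c d"
  shows "x \<in> {c, d} \<Longrightarrow> \<not> (above t a x \<and> above t x b) \<and> \<not> (above t b x \<and> above t x a)"
    "x \<in> {a, b} \<Longrightarrow> \<not> (above t c x \<and> above t x d) \<and> \<not> (above t d x \<and> above t x c)"
proof -
  obtain C D where C: "C \<in> clusters t" "{a, b} \<subseteq> C" "{c, d} \<inter> C = {}"
    and D: "D \<in> clusters t" "{c, d} \<subseteq> D" "{a, b} \<inter> D = {}"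
    using assms(2,3) by (auto elim: balancedE)
  show "x \<in> {c, d} \<Longrightarrow> \<not> (above t a x \<and> above t x b) \<and> \<not> (above t b x \<and> above t x a)"
    using clusters_interval[OF assms(1) C(1), of a b x] clusters_interval[OF assms(1) C(1), of b a x]
      C(2,3) by blast
  show "x \<in> {a, b} \<Longrightarrow> \<not> (above t c x \<and> above t x d) \<and> \<not> (above t d x \<and> above t x c)"
    using clusters_interval[OF assms(1) D(1), of c d x] clusters_interval[OF assms(1) D(1), of d c x]
      D(2,3) by blast
qed

section \<open>Planarity and the two critical tanglegrams\<close>

section \<open>Planarity and crossing-critical tanglegrams\<close>

text \<open>A planar layout may also carry new leaf names; renaming preserves \<open>above\<close>,
  so the crossing-free property can be read off before the renaming.\<close>

lemma switches_not_crossing: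
  assumes "planar (abs_tanglegram (diagonal L R))" "is_layout (diagonal L R)"
  obtains L' R' where "switch_tree\<^sup>*\<^sup>* L L'" "switch_tree\<^sup>*\<^sup>* R R'"
    "\<And>x y. x \<in> leaf_set L \<Longrightarrow> y \<in> leaf_set L \<Longrightarrow> \<not> (above L' x y \<and> above R' y x)"
proof -
  obtain X where X: "is_layout X" "abs_tanglegram X = abs_tanglegram (diagonal L R)"
    and no: "\<forall>e \<in> matching X. \<forall>f \<in> matching X. \<not> crossing X e f"
    using assms(1) unfolding planar_def layout_of_def by blast
  have "layout_equiv (diagonal L R) X"
    using abs_tanglegram_eq_iff[OF assms(2) X(1)] X(2) by simp
  then obtain Z f g where Z: "switch\<^sup>*\<^sup>* (diagonal L R) Z" and XZ: "X = rename f g Z"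
    unfolding layout_equiv_def by blast
  from Z obtain L' R' where Z': "Z = Layout L' R' (Id_on (leaf_set L))"
    and sw: "switch_tree\<^sup>*\<^sup>* L L'" "switch_tree\<^sup>*\<^sup>* R R'"
    unfolding diagonal_def by (rule switches_LayoutE)
  have X': "X = Layout (map_ptree f L') (map_ptree g R') (map_prod f g ` Id_on (leaf_set L))"
    by (simp add: XZ Z')
  have "\<not> (above L' x y \<and> above R' y x)" if "x \<in> leaf_set L" "y \<in> leaf_set L" for x y
  proof
    assume "above L' x y \<and> above R' y x"
    then have "crossing X (f x, g x) (f y, g y)"
      unfolding crossing_def X' by (simp add: above_map)
    moreover have "(f x, g x) \<in> matching X" "(f y, g y) \<in> matching X"
      using that unfolding X' by force+
    ultimately show False using no by blast
  qed
  then show ?thesis using that sw by blast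
qed

text \<open>Switches keep the obstruction, and without crossings both trees show the same leaf
  order. No order of four leaves satisfies the betweenness constraints of both induced
  trees.\<close>

lemma obstructed_not_planar:
  assumes "obstructed L R" "distinct (leaves L)" "distinct (leaves R)" "leaf_set L = leaf_set R"
  shows "\<not> planar (abs_tanglegram (diagonal L R))"
proof
  assume "planar (abs_tanglegram (diagonal L R))"
  moreover have "is_layout (diagonal L R)"
    unfolding diagonal_def using assms(2-4) by (rule tanglegram_of_is_layout)
  ultimately obtain L' R' where sw: "switch_tree\<^sup>*\<^sup>* L L'" "switch_tree\<^sup>*\<^sup>* R R'"
    and nc: "\<And>x y. x \<in> leaf_set L \<Longrightarrow> y \<in> leaf_set L \<Longrightarrow> \<not> (above L' x y \<and> above R' y x)"
    using switches_not_crossing by blast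
  have dL: "distinct (leaves L')" and dR: "distinct (leaves R')"
    using switches_distinct sw assms(2,3) by blast+
  have lL: "leaf_set L' = leaf_set L" and lR: "leaf_set R' = leaf_set L"
    using switches_leaf_set[OF sw(1)] switches_leaf_set[OF sw(2)] assms(4) by simp_all
  \<comment> \<open>Both orders are total on the same leaves, so having no opposite pair makes them
    equal.\<close>
  have same: "above R' = above L'"
  proof (intro ext)
    fix x y
    show "above R' x y \<longleftrightarrow> above L' x y"
      using nc[of x y] nc[of y x] above_total[of x L' y] above_total[of x R' y] lL lR
        above_leaves[of L' x y] above_leaves[of R' x y] above_asym[OF dL, of x x]
        above_asym[OF dR, of x x]
      by (cases "x = y") auto
  qed
  have above_iff: "above L' y x \<longleftrightarrow> \<not> above L' x y"
    if "x \<in> leaf_set L'" "y \<in> leaf_set L'" "x \<noteq> y" for x y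
    using that above_total[of x L' y] above_asym[OF dL, of x y] by blast
  have "obstructed L' R'"
    using obstructed_mono[OF assms(1)] clusters_switches[OF sw(1)] clusters_switches[OF sw(2)]
    by simp
  then show False
  proof (cases rule: obstructedE)
    case (caterpillars a b c d)
    have "distinct [a, d, c, b]" using caterpillars(1) by auto
    note R = caterpillar_betweenness[OF dR this caterpillars(4), unfolded same]
    note L = caterpillar_betweenness[OF dL caterpillars(1,3)]
    have ord: "above L' b a \<longleftrightarrow> \<not> above L' a b" "above L' c a \<longleftrightarrow> \<not> above L' a c"
      "above L' d a \<longleftrightarrow> \<not> above L' a d" "above L' c b \<longleftrightarrow> \<not> above L' b c"
      "above L' d b \<longleftrightarrow> \<not> above L' b d" "above L' d c \<longleftrightarrow> \<not> above L' c d"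
      using caterpillars(1,2) by (intro above_iff; simp)+
    \<comment> \<open>The left tree puts \<open>d\<close> at an end of the four leaves and the right
      tree puts \<open>b\<close> at an end. Then \<open>c\<close> would lie between \<open>a\<close>
      and \<open>b\<close> or between \<open>a\<close> and \<open>d\<close>, which the cherries of
      the two caterpillars forbid.\<close>
    show ?thesis
      using ord L(1,2) L(3)[of a b, simplified] L(3)[of b a, simplified] L(3)[of a c, simplified]
        L(3)[of c a, simplified] L(3)[of b c, simplified] L(3)[of c b, simplified]
        R(1,2) R(3)[of a d, simplified] R(3)[of d a, simplified] R(3)[of a c, simplified]
        R(3)[of c a, simplified] R(3)[of d c, simplified] R(3)[of c d, simplified]
      by argo
  next
    case (balanced a b c d)
    have "distinct [a, c, b, d]" using balanced(1) by auto
    note R = balanced_betweenness[OF dR this balanced(4), unfolded same]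
    note L = balanced_betweenness[OF dL balanced(1,3)]
    have ord: "above L' b a \<longleftrightarrow> \<not> above L' a b" "above L' c a \<longleftrightarrow> \<not> above L' a c"
      "above L' d a \<longleftrightarrow> \<not> above L' a d" "above L' c b \<longleftrightarrow> \<not> above L' b c"
      "above L' d b \<longleftrightarrow> \<not> above L' b d" "above L' d c \<longleftrightarrow> \<not> above L' c d"
      using balanced(1,2) by (intro above_iff; simp)+
    \<comment> \<open>The first two of the four leaves would have to be one of the pairs
      \<open>a, b\<close> and \<open>c, d\<close>, and also one of the pairs \<open>a, c\<close> and
      \<open>b, d\<close>.\<close>
    show ?thesis
      using ord L(1)[of c, simplified] L(1)[of d, simplified] L(2)[of a, simplified]
        L(2)[of b, simplified] R(1)[of b, simplified] R(1)[of d, simplified]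
        R(2)[of a, simplified] R(2)[of c, simplified]
      by argo
  qed
qed

text \<open>The common leaf order gives a drawing in which all matching edges are parallel.\<close>

lemma not_obstructed_planar:
  assumes "\<not> obstructed L R" "distinct (leaves L)" "distinct (leaves R)" "leaf_set L = leaf_set R"
  shows "planar (abs_tanglegram (diagonal L R))"
proof -
  obtain L' R' where sw: "switch_tree\<^sup>*\<^sup>* L L'" "switch_tree\<^sup>*\<^sup>* R R'" and eq: "leaves L' = leaves R'"
    using common_leaf_order[OF assms(2-4,1)] by blast
  let ?X = "Layout L' R' (Id_on (leaf_set L))"
  have equiv: "layout_equiv (diagonal L R) ?X"
    unfolding diagonal_def
    using switches_Layout[OF sw] tanglegram_of_is_layout[OF assms(2-4)]
    by (rule layout_equiv_switches)
  then have "layout_of ?X (abs_tanglegram (diagonal L R))"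
    unfolding layout_of_def using abs_tanglegram_eq_iff layout_equiv_def by metis
  moreover have "\<not> crossing ?X e f" if "e \<in> Id_on (leaf_set L)" "f \<in> Id_on (leaf_set L)" for e f
  proof -
    have "above R' = above L'" by (auto simp: above_def eq fun_eq_iff)
    then show ?thesis
      using that above_asym[of L'] switches_distinct[OF sw(1)] assms(2)
      by (auto simp: crossing_def)
  qed
  ultimately show ?thesis unfolding planar_def by fastforce
qed

text \<open>An obstruction involves four distinct leaves.\<close>

lemma planar_if_card_le_3:
  assumes "is_layout X" "card (matching X) \<le> 3"
  shows "planar (abs_tanglegram X)"
proof -
  let ?L = "left_tree X"
  obtain R where R: "distinct (leaves R)" "leaf_set ?L = leaf_set R"
    and equiv: "layout_equiv X (diagonal ?L R)"
    using layout_equiv_diagonal[OF assms(1)] .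
  have fin: "finite (matching X)"
    using assms(1) finite_subset finite_leaf_set[of ?L] finite_leaf_set[of "right_tree X"]
    unfolding is_layout_def by (meson finite_SigmaI)
  have "leaf_set ?L \<subseteq> fst ` matching X"
    using assms(1) unfolding is_layout_def by force
  then have le: "card (leaf_set ?L) \<le> 3"
    using card_image_le[OF fin, of fst] card_mono[of "fst ` matching X" "leaf_set ?L"] fin assms(2)
    by simp
  have "\<not> obstructed ?L R"
  proof
    assume "obstructed ?L R"
    then obtain a b c d where abcd: "distinct [a, b, c, d]" "{a, b, c, d} \<subseteq> leaf_set ?L"
      by (rule obstructedE) blast+
    then show False using card_mono[OF finite_leaf_set abcd(2)] le by simp
  qed
  then have "planar (abs_tanglegram (diagonal ?L R))"
    using not_obstructed_planar R assms(1) unfolding is_layout_def by blast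
  moreover have "abs_tanglegram X = abs_tanglegram (diagonal ?L R)"
    using equiv abs_tanglegram_eq_iff unfolding layout_equiv_def by blast
  ultimately show ?thesis by simp
qed

text \<open>Identifies an induced subtanglegram: by \<open>switches_if_clusters_subset\<close>, the
  prescribed trees \<open>S\<close> and \<open>U\<close> are switched forms of the restricted trees,
  and \<open>f\<close> then changes the names.\<close>

lemma abs_induced_diagonal:
  assumes dist: "distinct (leaves L)" "distinct (leaves R)" "leaf_set L = leaf_set R"
    and A: "A \<subseteq> leaf_set L" "A \<noteq> {}"
    and S: "distinct (leaves S)" "leaf_set S = A" "clusters S \<subseteq> clusters (restrict_tree A L)"
    and U: "distinct (leaves U)" "leaf_set U = A" "clusters U \<subseteq> clusters (restrict_tree A R)"
    and f: "inj_on f A"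
  shows "abs_tanglegram (induced_layout (diagonal L R) (Id_on A)) =
    tanglegram_of (map_ptree f S) (map_ptree f U)"
proof -
  have "leaf_set (restrict_tree A L) = A" "leaf_set (restrict_tree A R) = A"
    using A dist(3) restrict_tree_leaf_set[of L A] restrict_tree_leaf_set[of R A] by blast+
  then have sw: "switch_tree\<^sup>*\<^sup>* S (restrict_tree A L)" "switch_tree\<^sup>*\<^sup>* U (restrict_tree A R)"
    using switches_if_clusters_subset S U restrict_tree_distinct dist(1,2) by metis+
  have "fst ` Id_on A = A" "snd ` Id_on A = A" by force+
  then have ind: "induced_layout (diagonal L R) (Id_on A) =
      Layout (restrict_tree A L) (restrict_tree A R) (Id_on A)"
    by (simp add: diagonal_def)
  have lay: "is_layout (diagonal S U)"
    unfolding diagonal_def using S U by (intro tanglegram_of_is_layout) simp_all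
  have "layout_equiv (diagonal S U) (induced_layout (diagonal L R) (Id_on A))"
    unfolding ind using switches_Layout[OF sw] lay S(2) unfolding diagonal_def
    by (intro layout_equiv_switches) simp_all
  moreover have "map_prod f f ` Id_on A = Id_on (f ` A)" by force
  then have ren: "rename f f (diagonal S U) = diagonal (map_ptree f S) (map_ptree f U)"
    using S(2) by (simp add: diagonal_def ptree.set_map)
  have "is_layout (diagonal (map_ptree f S) (map_ptree f U))"
    unfolding diagonal_def using S U f
    by (intro tanglegram_of_is_layout) (simp_all add: leaves_map distinct_map set_leaves ptree.set_map)
  then have "layout_equiv (diagonal S U) (diagonal (map_ptree f S) (map_ptree f U))"
    using layout_equiv_rename[OF lay, of f f] f S(2) U(2)
    by (simp add: ren left_diagonal right_diagonal)
  ultimately have "layout_equiv (induced_layout (diagonal L R) (Id_on A))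
      (diagonal (map_ptree f S) (map_ptree f U))"
    using layout_equiv_sym layout_equiv_trans by blast
  then show ?thesis
    unfolding tanglegram_of_def diagonal_def[symmetric]
    using abs_tanglegram_eq_iff layout_equiv_def by blast
qed

text \<open>The target tree has seven clusters: four singletons, the full set, and the traces of the
  two witnesses.\<close>

lemma caterpillar_clusters_restrict:
  assumes "caterpillar t a b c d" "{a, b, c, d} \<subseteq> leaf_set t"
  shows "clusters (Node (Node (Node (Leaf a) (Leaf b)) (Leaf c)) (Leaf d)) \<subseteq>
    clusters (restrict_tree {a, b, c, d} t)"
proof -
  let ?A = "{a, b, c, d}"
  have ls: "leaf_set (restrict_tree ?A t) = ?A"
    using restrict_tree_leaf_set[of t ?A] assms(2) by blast
  obtain C D where "C \<in> clusters t" "D \<in> clusters t" "C \<inter> ?A = {a, b}" "D \<inter> ?A = {a, b, c}"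
    using assms(1) unfolding caterpillar_def by blast
  then have "{a, b} \<in> clusters (restrict_tree ?A t)" "{a, b, c} \<in> clusters (restrict_tree ?A t)"
    using clusters_restrict_tree[of C t ?A] clusters_restrict_tree[of D t ?A] by simp_all
  moreover have "?A \<in> clusters (restrict_tree ?A t)"
    using leaf_set_in_clusters[of "restrict_tree ?A t"] ls by simp
  moreover have "{x} \<in> clusters (restrict_tree ?A t)" if "x \<in> ?A" for x
    using singleton_in_clusters[of x "restrict_tree ?A t"] that ls by simp
  ultimately show ?thesis by (simp add: Un_commute insert_commute)
qed

lemma balanced_clusters_restrict:
  assumes "balanced t a b c d" "{a, b, c, d} \<subseteq> leaf_set t"
  shows "clusters (Node (Node (Leaf a) (Leaf b)) (Node (Leaf c) (Leaf d))) \<subseteq>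
    clusters (restrict_tree {a, b, c, d} t)"
proof -
  let ?A = "{a, b, c, d}"
  have ls: "leaf_set (restrict_tree ?A t) = ?A"
    using restrict_tree_leaf_set[of t ?A] assms(2) by blast
  obtain C D where "C \<in> clusters t" "D \<in> clusters t" "C \<inter> ?A = {a, b}" "D \<inter> ?A = {c, d}"
    using assms(1) unfolding balanced_def by blast
  then have "{a, b} \<in> clusters (restrict_tree ?A t)" "{c, d} \<in> clusters (restrict_tree ?A t)"
    using clusters_restrict_tree[of C t ?A] clusters_restrict_tree[of D t ?A] by simp_all
  moreover have "?A \<in> clusters (restrict_tree ?A t)"
    using leaf_set_in_clusters[of "restrict_tree ?A t"] ls by simp
  moreover have "{x} \<in> clusters (restrict_tree ?A t)" if "x \<in> ?A" for x
    using singleton_in_clusters[of x "restrict_tree ?A t"] that ls by simp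
  ultimately show ?thesis by (simp add: Un_commute insert_commute)
qed

lemma obstructed_induces:
  assumes "obstructed L R" "distinct (leaves L)" "distinct (leaves R)" "leaf_set L = leaf_set R"
  obtains A where "A \<subseteq> leaf_set L" "A \<noteq> {}"
    "abs_tanglegram (induced_layout (diagonal L R) (Id_on A)) \<in> {T1, T2}"
  using assms(1)
proof (cases rule: obstructedE)
  case (caterpillars a b c d)
  \<comment> \<open>Translates \<open>a\<close>, \<open>b\<close>, \<open>c\<close>,
    \<open>d\<close> into the labels 0, 1, 2, 3 of \<open>T1\<close>; the default 3 is the value at
    \<open>d\<close>.\<close>
  define f where "f x = (if x = a then 0 else if x = b then 1 else if x = c then 2 else 3 :: nat)"
    for x :: nat
  have f: "f a = 0" "f b = 1" "f c = 2" "f d = 3"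
    using caterpillars(1) by (auto simp: f_def)
  have perm: "{a, d, c, b} = {a, b, c, d}" by auto
  have "abs_tanglegram (induced_layout (diagonal L R) (Id_on {a, b, c, d})) =
    tanglegram_of (map_ptree f (Node (Node (Node (Leaf a) (Leaf b)) (Leaf c)) (Leaf d)))
      (map_ptree f (Node (Node (Node (Leaf a) (Leaf d)) (Leaf c)) (Leaf b)))"
    using caterpillars assms(2-4) f caterpillar_clusters_restrict[of L a b c d]
      caterpillar_clusters_restrict[of R a d c b, unfolded perm]
    by (intro abs_induced_diagonal) auto
  then have "abs_tanglegram (induced_layout (diagonal L R) (Id_on {a, b, c, d})) = T1"
    by (simp add: f T1_def)
  then show ?thesis using that[of "{a, b, c, d}"] caterpillars(2) by simp
next
  case (balanced a b c d)
  define f where "f x = (if x = a then 0 else if x = b then 1 else if x = c then 2 else 3 :: nat)"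
    for x :: nat
  have f: "f a = 0" "f b = 1" "f c = 2" "f d = 3"
    using balanced(1) by (auto simp: f_def)
  have perm: "{a, c, b, d} = {a, b, c, d}" by auto
  have "abs_tanglegram (induced_layout (diagonal L R) (Id_on {a, b, c, d})) =
    tanglegram_of (map_ptree f (Node (Node (Leaf a) (Leaf b)) (Node (Leaf c) (Leaf d))))
      (map_ptree f (Node (Node (Leaf a) (Leaf c)) (Node (Leaf b) (Leaf d))))"
    using balanced assms(2-4) f balanced_clusters_restrict[of L a b c d]
      balanced_clusters_restrict[of R a c b d, unfolded perm]
    by (intro abs_induced_diagonal) auto
  then have "abs_tanglegram (induced_layout (diagonal L R) (Id_on {a, b, c, d})) = T2"
    by (simp add: f T2_def)
  then show ?thesis using that[of "{a, b, c, d}"] balanced(2) by simp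
qed

text \<open>Contrapositive of \<open>not_obstructed_planar\<close>, applied to a layout in normal
  form. The explicit edge set allows the case where it is the whole matching to be
  separated.\<close>

lemma not_planar_induces:
  assumes "\<not> planar T"
  obtains L R A where "layout_of (diagonal L R) T" "A \<subseteq> leaf_set L" "A \<noteq> {}"
    "abs_tanglegram (induced_layout (diagonal L R) (Id_on A)) \<in> {T1, T2}"
proof -
  obtain X where X: "is_layout X" "abs_tanglegram X = T"
    using layout_of_exists[of T] unfolding layout_of_def by blast
  let ?L = "left_tree X"
  obtain R where R: "distinct (leaves R)" "leaf_set ?L = leaf_set R"
    and equiv: "layout_equiv X (diagonal ?L R)"
    using layout_equiv_diagonal[OF X(1)] .
  have L: "distinct (leaves ?L)" using X(1) unfolding is_layout_def by blast
  have T: "layout_of (diagonal ?L R) T"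
    using equiv X abs_tanglegram_eq_iff[of X "diagonal ?L R"]
    unfolding layout_of_def layout_equiv_def by simp
  then have "obstructed ?L R"
    using assms not_obstructed_planar[OF _ L R] unfolding layout_of_def by blast
  then show ?thesis using obstructed_induces[OF _ L R] that[OF T] by blast
qed

lemma restrict_tree_leaf_set_id: "leaf_set t \<subseteq> A \<Longrightarrow> restrict_tree A t = t"
  by (induction t) (auto simp: Int_absorb2 leaf_set_nonempty)

lemma induced_layout_matching:
  assumes "is_layout X" shows "induced_layout X (matching X) = X"
proof (cases X)
  case (Layout L R M)
  have "leaf_set L \<subseteq> fst ` M" "leaf_set R \<subseteq> snd ` M"
    using assms Layout unfolding is_layout_def by force+
  then show ?thesis using Layout by (simp add: restrict_tree_leaf_set_id)
qed

text \<open>A proper subset of at most four edges has at most three, which always gives a planar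
  tanglegram.\<close>

lemma crossing_critical_if_obstructed_size_4:
  assumes "obstructed L R" "distinct (leaves L)" "distinct (leaves R)" "leaf_set L = leaf_set R"
    and "card (leaf_set L) \<le> 4"
  shows "crossing_critical (tanglegram_of L R)"
proof -
  have T: "tanglegram_of L R = abs_tanglegram (diagonal L R)"
    by (simp add: tanglegram_of_def diagonal_def)
  have lay: "is_layout (diagonal L R)"
    unfolding diagonal_def using assms(2-4) by (rule tanglegram_of_is_layout)
  have "planar S" if S: "proper_induced_subtanglegram S (tanglegram_of L R)" for S
  proof -
    obtain X E where X: "is_layout X" "abs_tanglegram X = abs_tanglegram (diagonal L R)"
      and E: "E \<subset> matching X" "E \<noteq> {}" and S: "S = abs_tanglegram (induced_layout X E)"
      using S unfolding proper_induced_subtanglegram_def layout_of_def T by blast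
    have "layout_equiv (diagonal L R) X"
      using abs_tanglegram_eq_iff[OF lay X(1)] X(2) by simp
    then obtain Z f g where "switch\<^sup>*\<^sup>* (diagonal L R) Z" and XZ: "X = rename f g Z"
      unfolding layout_equiv_def by blast
    \<comment> \<open>Properness refers to an arbitrary layout \<open>X\<close> of the tanglegram.
      Its matching is an image of the original one under renaming, so it has at most four edges
      too.\<close>
    then have "matching Z = Id_on (leaf_set L)"
      using switches_leaf_sets matching_diagonal by blast
    then have M: "matching X = map_prod f g ` Id_on (leaf_set L)" unfolding XZ by (cases Z) simp
    have Id: "Id_on (leaf_set L) = (\<lambda>x. (x, x)) ` leaf_set L" by auto
    have fin: "finite (matching X)" unfolding M Id by (simp add: finite_leaf_set)
    have "card (matching X) \<le> card (leaf_set L)"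
      unfolding M Id image_image by (rule card_image_le[OF finite_leaf_set])
    then have "card E \<le> 3" using psubset_card_mono[OF fin E(1)] assms(5) by simp
    moreover have "matching (induced_layout X E) = E" by (cases X) simp
    moreover have "is_layout (induced_layout X E)"
      using induced_layout_is_layout[OF X(1)] E by blast
    ultimately show ?thesis unfolding S by (intro planar_if_card_le_3) simp_all
  qed
  then show ?thesis
    unfolding crossing_critical_def using obstructed_not_planar[OF assms(1-4)] T by simp
qed

lemma crossing_critical_T1: "crossing_critical T1"
proof -
  let ?L = "Node (Node (Node (Leaf 0) (Leaf 1)) (Leaf 2)) (Leaf (3::nat))"
  let ?R = "Node (Node (Node (Leaf 0) (Leaf 3)) (Leaf 2)) (Leaf (1::nat))"
  have "caterpillar ?L 0 1 2 3" by (rule caterpillarI[of "{0, 1}" _ "{0, 1, 2}"]) auto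
  moreover have "caterpillar ?R 0 3 2 1" by (rule caterpillarI[of "{0, 3}" _ "{0, 2, 3}"]) auto
  ultimately have "obstructed ?L ?R" by (intro obstructedI_caterpillars[of 0 1 2 3]) auto
  then show ?thesis
    unfolding T1_def by (intro crossing_critical_if_obstructed_size_4) auto
qed

lemma crossing_critical_T2: "crossing_critical T2"
proof -
  let ?L = "Node (Node (Leaf 0) (Leaf 1)) (Node (Leaf 2) (Leaf (3::nat)))"
  let ?R = "Node (Node (Leaf 0) (Leaf 2)) (Node (Leaf 1) (Leaf (3::nat)))"
  have "balanced ?L 0 1 2 3" by (rule balancedI[of "{0, 1}" _ "{2, 3}"]) auto
  moreover have "balanced ?R 0 2 1 3" by (rule balancedI[of "{0, 2}" _ "{1, 3}"]) auto
  ultimately have "obstructed ?L ?R" by (intro obstructedI_balanced[of 0 1 2 3]) auto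
  then show ?thesis
    unfolding T2_def by (intro crossing_critical_if_obstructed_size_4) auto
qed

theorem theorem1:
  shows "(\<forall>T. crossing_critical T \<longleftrightarrow> T = T1 \<or> T = T2) \<and>
    (\<forall>T. \<not> planar T \<longrightarrow> induced_subtanglegram T1 T \<or> induced_subtanglegram T2 T)"
proof (intro conjI allI impI)
  fix T
  show "crossing_critical T \<longleftrightarrow> T = T1 \<or> T = T2"
  proof
    assume crit: "crossing_critical T"
    then have "\<not> planar T" by (simp add: crossing_critical_def)
    then obtain L R A where T: "layout_of (diagonal L R) T" and A: "A \<subseteq> leaf_set L" "A \<noteq> {}"
      and T12: "abs_tanglegram (induced_layout (diagonal L R) (Id_on A)) \<in> {T1, T2}"
      by (rule not_planar_induces)
    show "T = T1 \<or> T = T2"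
    \<comment> \<open>If all edges are used, the induced layout is the layout itself. Otherwise
      criticality would make the induced \<open>T1\<close> or \<open>T2\<close> planar, although
      both are non-planar.\<close>
    proof (cases "A = leaf_set L")
      case True
      then show ?thesis
        using T12 T induced_layout_matching[of "diagonal L R"]
        by (simp add: layout_of_def matching_diagonal)
    next
      case False
      then have "Id_on A \<subset> matching (diagonal L R)" "Id_on A \<noteq> {}"
        using A unfolding matching_diagonal by blast+
      then have "planar (abs_tanglegram (induced_layout (diagonal L R) (Id_on A)))"
        using T crit unfolding crossing_critical_def proper_induced_subtanglegram_def by blast
      then show ?thesis
        using T12 crossing_critical_T1 crossing_critical_T2 unfolding crossing_critical_def by auto
    qed
  next
    assume "T = T1 \<or> T = T2"
    then show "crossing_critical T" using crossing_critical_T1 crossing_critical_T2 by blast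
  qed
next
  fix T assume "\<not> planar T"
  then obtain L R A where "layout_of (diagonal L R) T" "A \<subseteq> leaf_set L" "A \<noteq> {}"
    and T12: "abs_tanglegram (induced_layout (diagonal L R) (Id_on A)) \<in> {T1, T2}"
    by (rule not_planar_induces)
  then have "layout_of (diagonal L R) T" "Id_on A \<subseteq> matching (diagonal L R)" "Id_on A \<noteq> {}"
    unfolding matching_diagonal by blast+
  then have "induced_subtanglegram (abs_tanglegram (induced_layout (diagonal L R) (Id_on A))) T"
    unfolding induced_subtanglegram_def by blast
  then show "induced_subtanglegram T1 T \<or> induced_subtanglegram T2 T" using T12 by auto
qed

end
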